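(* Let $\kappa,k\in L^1(0,T)$ be a Sonine pair, i.e. $(\kappa*k)(t)=1$ for $0<t\le T$. Assume $|\kappa(t)|\le C_\kappa t^{\eta_\kappa-1}$ on $(0,T]$ for some $C_\kappa,\eta_\kappa>0$, and that $\kappa$ does not vanish almost everywhere on any interval $(0,\varepsilon)$, $\varepsilon>0$. Let $k_1,\dots,k_N\in L^1(0,T)$ be such that $g_j:=k_j*\kappa\in \mathrm{AC}[0,T]$, $g_j(0)=0$, and $q_j:=g_j'$ satisfies $|q_j(t)|\le C_jt^{\eta_j-1}$ a.e. for some $C_j,\eta_j>0$. Let $p_0,p_1,\dots,p_N\in C[0,T]$ and $K\in C(\Delta_T)$. Then, for every $f\in C[0,T]$, the equation $$D_ku(t)+p_0(t)u(t)+\sum_{j=1}^{N}p_j(t)D_{k_j}u(t)+\int_0^tK(t,s)u(s)\,ds=f(t)$$ has a unique solution in $I_\kappa(C[0,T])$. It is $u=I_\kappa(I-V_{R_S})f$, where $R_S$ is the resolvent kernel generated by $$G_S(t,s)=p_0(t)\kappa(t-s)+\sum_{j=1}^{N}p_j(t)q_j(t-s)+\int_s^tK(t,\xi)\kappa(\xi-s)\,d\xi .$$ (Beyond continuity of $K$ on $\Delta_T$, no convolution structure on $K$ is required, and no norm-smallness condition on the coefficients or on $K$ is imposed.)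
   Context: Fix $T>0$; functions are complex-valued; $\Delta_T=\{(t,s):0\le s\le t\le T\}$; $(a*b)(t)=\int_0^ta(t-s)b(s)\,ds$. For a univariate kernel $r\in L^1(0,T)$, $V_rf=r*f$; for a bivariate kernel $G$, $(V_Gf)(t)=\int_0^tG(t,s)f(s)\,ds$. $\mathrm{AC}[0,T]$ is the space of absolutely continuous functions. $I_\kappa:=V_\kappa$, which is injective on $C[0,T]$ under the stated hypotheses. On $I_\kappa(C[0,T])$ define $D_ku=\frac{d}{dt}V_ku$ (so $D_k=I_\kappa^{-1}$ there, since $V_kI_\kappa v=\int_0^tv$) and $D_{k_j}u=(V_{k_j}u)'$ (for $u=I_\kappa v$ with $v\in C[0,T]$ one has $V_{k_j}u\in C^1[0,T]$ and $D_{k_j}u=V_{q_j}v$). All terms of the equation are elements of $C[0,T]$. Resolvent kernel: for a measurable kernel $G$ on $\{0\le s<t\le T\}$ with $V_G:C[0,T]\to C[0,T]$ and $|G(t,s)|\le C(t-s)^{\eta-1}$ a.e. for some $C,\eta>0$, put $G_1=G$, $G_{n+1}(t,s)=\int_s^tG(t,\xi)G_n(\xi,s)\,d\xi$; the resolvent kernel generated by $G$ is $R_G(t,s)=\sum_{n\ge1}(-1)^{n-1}G_n(t,s)$ (the series converges absolutely for a.e. $(t,s)$, and the induced operator series converges in operator norm on $C[0,T]$ to $V_{R_G}$). *)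

theory Defs
  imports "HOL-Analysis.Analysis"
begin

text \<open>
  Functions on \<open>[0,T]\<close> are represented by total functions on the reals. The members of
  \<open>C[0,T]\<close> are taken to be \<open>undefined\<close> off \<open>[0,T]\<close>, so that HOL equality of two members is
  equality on \<open>[0,T]\<close> and uniqueness can be expressed by \<open>\<exists>!\<close>.
\<close>

definition C_space :: "real \<Rightarrow> (real \<Rightarrow> complex) set" where
  "C_space T = {f \<in> extensional {0..T}. continuous_on {0..T} f}"

definition absolutely_continuous_on :: "real \<Rightarrow> real \<Rightarrow> (real \<Rightarrow> complex) \<Rightarrow> bool" where
  "absolutely_continuous_on c d g \<longleftrightarrow>
     (\<forall>\<epsilon>>0. \<exists>\<delta>>0. \<forall>(n::nat) a b.
        (\<forall>i<n. c \<le> a i \<and> a i \<le> b i \<and> b i \<le> d) \<longrightarrow>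
        disjoint_family_on (\<lambda>i. {a i<..<b i}) {..<n} \<longrightarrow>
        (\<Sum>i<n. b i - a i) < \<delta> \<longrightarrow>
        (\<Sum>i<n. norm (g (b i) - g (a i))) < \<epsilon>)"

definition conv :: "(real \<Rightarrow> complex) \<Rightarrow> (real \<Rightarrow> complex) \<Rightarrow> real \<Rightarrow> complex" where
  "conv a b t = (LINT s:{0..t}|lebesgue. a (t - s) * b s)"

definition conv_op ::
  "real \<Rightarrow> (real \<Rightarrow> complex) \<Rightarrow> (real \<Rightarrow> complex) \<Rightarrow> real \<Rightarrow> complex" where
  "conv_op T r f = (\<lambda>t\<in>{0..T}. conv r f t)"

definition volterra_op ::
  "real \<Rightarrow> (real \<Rightarrow> real \<Rightarrow> complex) \<Rightarrow> (real \<Rightarrow> complex) \<Rightarrow> real \<Rightarrow> complex" where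
  "volterra_op T G f = (\<lambda>t\<in>{0..T}. LINT s:{0..t}|lebesgue. G t s * f s)"

definition sonine_pair :: "real \<Rightarrow> (real \<Rightarrow> complex) \<Rightarrow> (real \<Rightarrow> complex) \<Rightarrow> bool" where
  "sonine_pair T \<kappa> k \<longleftrightarrow>
     set_integrable lebesgue {0<..<T} \<kappa> \<and> set_integrable lebesgue {0<..<T} k \<and>
     (\<forall>t\<in>{0<..T}. conv \<kappa> k t = 1)"

text \<open>
  The derivative is one-sided at the endpoints of \<open>[0,T]\<close>. It is only used for
  \<open>u \<in> I\<^sub>\<kappa>(C[0,T])\<close>, where \<open>V\<^sub>r u\<close> is continuously differentiable for the kernels \<open>r\<close> in question,
  so the unspecified value of \<^const>\<open>vector_derivative\<close> at points of non-differentiability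
  plays no role.
\<close>

definition D_op ::
  "real \<Rightarrow> (real \<Rightarrow> complex) \<Rightarrow> (real \<Rightarrow> complex) \<Rightarrow> real \<Rightarrow> complex" where
  "D_op T r u t = vector_derivative (conv_op T r u) (at t within {0..T})"

text \<open>\<open>iterated_kernel G n\<close> is the kernel \<open>G\<^sub>n\<^sub>+\<^sub>1\<close>, i.e. the numbering is shifted to start at \<open>0\<close>.\<close>

primrec iterated_kernel ::
  "(real \<Rightarrow> real \<Rightarrow> complex) \<Rightarrow> nat \<Rightarrow> real \<Rightarrow> real \<Rightarrow> complex" where
  "iterated_kernel G 0 = G"
| "iterated_kernel G (Suc n) =
     (\<lambda>t s. LINT \<xi>:{s..t}|lebesgue. G t \<xi> * iterated_kernel G n \<xi> s)"

definition resolvent_kernel ::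
  "(real \<Rightarrow> real \<Rightarrow> complex) \<Rightarrow> real \<Rightarrow> real \<Rightarrow> complex" where
  "resolvent_kernel G t s = (\<Sum>n. (-1) ^ n * iterated_kernel G n t s)"

definition solves_equation ::
  "real \<Rightarrow> (real \<Rightarrow> complex) \<Rightarrow> nat \<Rightarrow> (nat \<Rightarrow> real \<Rightarrow> complex) \<Rightarrow> (nat \<Rightarrow> real \<Rightarrow> complex) \<Rightarrow>
   (real \<Rightarrow> real \<Rightarrow> complex) \<Rightarrow> (real \<Rightarrow> complex) \<Rightarrow> (real \<Rightarrow> complex) \<Rightarrow> bool" where
  "solves_equation T k N kj p K f u \<longleftrightarrow>
     (\<forall>t\<in>{0..T}.
        D_op T k u t + p 0 t * u t + (\<Sum>j=1..N. p j t * D_op T (kj j) u t)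
          + (LINT s:{0..t}|lebesgue. K t s * u s) = f t)"

definition G_S ::
  "(real \<Rightarrow> complex) \<Rightarrow> nat \<Rightarrow> (nat \<Rightarrow> real \<Rightarrow> complex) \<Rightarrow> (nat \<Rightarrow> real \<Rightarrow> complex) \<Rightarrow>
   (real \<Rightarrow> real \<Rightarrow> complex) \<Rightarrow> real \<Rightarrow> real \<Rightarrow> complex" where
  "G_S \<kappa> N q p K t s =
     p 0 t * \<kappa> (t - s) + (\<Sum>j=1..N. p j t * q j (t - s))
       + (LINT \<xi>:{s..t}|lebesgue. K t \<xi> * \<kappa> (\<xi> - s))"

end

theory Submission
  imports Defs
begin

text \<open>
  On the range of \<open>I\<^sub>\<kappa>\<close> every term of the equation is a Volterra operator applied to \<open>v\<close>, where
  \<open>u = I\<^sub>\<kappa> v\<close>. By associativity of convolution \<open>V\<^sub>k I\<^sub>\<kappa> v = (k * \<kappa>) * v = 1 * v\<close>, so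
  \<open>D\<^sub>k u = v\<close> (\<open>D_op_sonine\<close>). An absolutely continuous \<open>g\<^sub>j\<close> with \<open>g\<^sub>j(0) = 0\<close> is the primitive of
  its derivative \<open>q\<^sub>j\<close> (\<open>absolutely_continuous_has_integral\<close>), so
  \<open>V u = g\<^sub>j * v = 1 * (q\<^sub>j * v)\<close> for the operator \<open>V\<close> with kernel \<open>k\<^sub>j\<close>, and its derivative is
  \<open>q\<^sub>j * v\<close> (\<open>D_op_primitive\<close>). By Fubini's theorem the memory term is the Volterra operator with
  kernel \<open>\<integral> K(t,\<xi>) \<kappa>(\<xi> - s) d\<xi>\<close>. The equation for \<open>u\<close> is therefore equivalent to the Volterra equation
  of the second kind \<open>v + V\<^sub>G v = f\<close> with \<open>G = G_S\<close>.

  The kernel \<open>G\<close> is dominated by \<open>h(t - s)\<close> with an integrable \<open>h\<close>, and this makes the Neumann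
  series converge without any smallness condition: by dominated convergence
  \<open>\<integral> h(x) exp(-\<mu> x) dx \<le> 1/2\<close> for large \<open>\<mu>\<close>, and the weight \<open>exp(-\<mu> (t - s))\<close> is multiplicative along
  the composition of kernels, so the weighted row integrals of the iterated kernels are at most
  \<open>2\<^sup>-\<^sup>n\<close> (\<open>weighted_power_bound\<close>). On the bounded interval the weight is bounded away from
  \<open>0\<close>. It follows that the series of iterated kernels converges absolutely almost everywhere in each
  row, that \<open>(I - V\<^sub>R) f\<close> is continuous and solves \<open>v + V\<^sub>G v = f\<close> (\<open>neumann_kernel_solves\<close>,
  \<open>continuous_on_kernel_op_neumann\<close>), and that \<open>v + V\<^sub>G v = 0\<close> forces \<open>v = 0\<close>
  (\<open>homogeneous_solution_zero\<close>).

  Fubini's theorem lives on the product of two Borel spaces, whereas the data are only Lebesgue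
  measurable and are given up to null sets. All kernels are therefore replaced by Borel
  representatives that vanish outside the relevant interval, and integrals over \<open>[0,t]\<close> become
  integrals over the whole line. Changing the one-variable data on a null set changes \<open>G(t,s)\<close> on a set
  that is null in every row and in every column. The first composition then removes the difference
  completely, so the iterated kernels from the second on agree everywhere.
\<close>

section \<open>Absolutely continuous functions as primitives\<close>

text \<open>
  Tagged divisions are finite sets of pairs, so the defining condition is needed for families of
  intervals over an arbitrary finite index set rather than over an initial segment of \<open>\<nat>\<close>.
\<close>

lemma absolutely_continuous_on_finite_family:
  assumes AC: "absolutely_continuous_on a b g" and "\<epsilon> > 0"
  obtains \<delta> where "\<delta> > 0"
    "\<And>(I :: 'i set) l u. \<lbrakk>finite I; \<And>i. i \<in> I \<Longrightarrow> a \<le> l i \<and> l i \<le> u i \<and> u i \<le> b;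
        disjoint_family_on (\<lambda>i. {l i<..<u i}) I; (\<Sum>i\<in>I. u i - l i) < \<delta>\<rbrakk>
      \<Longrightarrow> (\<Sum>i\<in>I. norm (g (u i) - g (l i))) < \<epsilon>"
proof -
  obtain \<delta> where "\<delta> > 0" and \<delta>: "\<And>(n::nat) l u. (\<forall>i<n. a \<le> l i \<and> l i \<le> u i \<and> u i \<le> b) \<Longrightarrow>
        disjoint_family_on (\<lambda>i. {l i<..<u i}) {..<n} \<Longrightarrow>
        (\<Sum>i<n. u i - l i) < \<delta> \<Longrightarrow> (\<Sum>i<n. norm (g (u i) - g (l i))) < \<epsilon>"
    using assms unfolding absolutely_continuous_on_def by blast
  show thesis
  proof (rule that[OF \<open>\<delta> > 0\<close>])
    fix I :: "'i set" and l u
    assume I: "finite I" "\<And>i. i \<in> I \<Longrightarrow> a \<le> l i \<and> l i \<le> u i \<and> u i \<le> b"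
      and disj: "disjoint_family_on (\<lambda>i. {l i<..<u i}) I" and small: "(\<Sum>i\<in>I. u i - l i) < \<delta>"
    obtain h where h: "bij_betw h {..<card I} I"
      using ex_bij_betw_nat_finite[OF \<open>finite I\<close>] by (auto simp: atLeast0LessThan)
    have *: "(\<Sum>i<card I. F (h i)) = sum F I" for F :: "'i \<Rightarrow> real"
      by (rule sum.reindex_bij_betw[OF h])
    have "(\<Sum>i<card I. norm (g (u (h i)) - g (l (h i)))) < \<epsilon>"
    proof (rule \<delta>)
      show "\<forall>i<card I. a \<le> l (h i) \<and> l (h i) \<le> u (h i) \<and> u (h i) \<le> b"
        using I h by (auto simp: bij_betw_def)
      show "disjoint_family_on (\<lambda>i. {l (h i)<..<u (h i)}) {..<card I}"
        unfolding disjoint_family_on_def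
      proof (intro ballI impI)
        fix i j assume "i \<in> {..<card I}" "j \<in> {..<card I}" "i \<noteq> j"
        then have "h i \<in> I" "h j \<in> I" "h i \<noteq> h j"
          using h by (auto simp: bij_betw_def inj_on_def)
        then show "{l (h i)<..<u (h i)} \<inter> {l (h j)<..<u (h j)} = {}"
          using disj by (auto simp only: disjoint_family_on_def)
      qed
      show "(\<Sum>i<card I. u (h i) - l (h i)) < \<delta>"
        using small *[of "\<lambda>i. u i - l i"] by simp
    qed
    then show "(\<Sum>i\<in>I. norm (g (u i) - g (l i))) < \<epsilon>"
      using *[of "\<lambda>i. norm (g (u i) - g (l i))"] by simp
  qed
qed

lemma sum_lengths_le_emeasure:
  fixes l u :: "'i \<Rightarrow> real"
  assumes "finite I" "\<And>i. i \<in> I \<Longrightarrow> l i \<le> u i" "disjoint_family_on (\<lambda>i. {l i<..<u i}) I"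
    and "\<And>i. i \<in> I \<Longrightarrow> {l i<..<u i} \<subseteq> U" and "open U"
  shows "ennreal (\<Sum>i\<in>I. u i - l i) \<le> emeasure lborel U"
proof -
  have "ennreal (\<Sum>i\<in>I. u i - l i) = (\<Sum>i\<in>I. emeasure lborel {l i<..<u i})"
    using assms(2) by (subst sum_ennreal[symmetric]) (auto intro!: sum.cong)
  also have "\<dots> = emeasure lborel (\<Union>i\<in>I. {l i<..<u i})"
    by (rule sum_emeasure) (use assms in auto)
  also have "\<dots> \<le> emeasure lborel U"
    by (rule emeasure_mono) (use assms in auto)
  finally show ?thesis .
qed

text \<open>
  The exceptional null set \<open>E\<close> is covered by an open set \<open>U\<close> of small measure. A gauge is chosen so that
  cells tagged in \<open>E\<close> lie in \<open>U\<close>, and cells tagged outside \<open>E\<close> are so short that the derivative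
  approximates the increment of \<open>g\<close>. In a fine division the cells of the second kind contribute an
  error proportional to their length. Those of the first kind have small total length, so absolute
  continuity makes the total increment of \<open>g\<close> over them small. This gives the fundamental theorem of calculus for the
  gauge integral without Lebesgue's differentiation theorem.
\<close>

theorem absolutely_continuous_has_integral:
  assumes "a \<le> b" and AC: "absolutely_continuous_on a b g" and E: "negligible E"
    and deriv: "\<And>t. t \<in> {a..b} - E \<Longrightarrow> (g has_vector_derivative q t) (at t within {a..b})"
  shows "(q has_integral g b - g a) {a..b}"
proof -
  \<comment> \<open>cells tagged in \<open>E\<close> must not contribute to the Riemann sum\<close>
  define q0 where "q0 t = (if t \<in> E then 0 else q t)" for t
  have "(q0 has_integral g b - g a) {a..b}"
    unfolding has_integral_real
  proof (intro allI impI)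
    fix e :: real assume "e > 0"
    define e1 where "e1 = e / (2 * (b - a + 1))"
    have "e1 > 0" using \<open>e > 0\<close> \<open>a \<le> b\<close> by (simp add: e1_def)
    have "e1 * (b - a + 1) = e / 2"
      using \<open>a \<le> b\<close> by (simp add: e1_def field_split_simps add_eq_0_iff)
    then have e1: "e1 * (b - a) < e / 2"
      using \<open>e1 > 0\<close> by (simp add: algebra_simps)
    obtain \<delta> where "\<delta> > 0" and \<delta>:
      "\<And>(I :: (real \<times> real set) set) l u. \<lbrakk>finite I; \<And>i. i \<in> I \<Longrightarrow> a \<le> l i \<and> l i \<le> u i \<and> u i \<le> b;
        disjoint_family_on (\<lambda>i. {l i<..<u i}) I; (\<Sum>i\<in>I. u i - l i) < \<delta>\<rbrakk>
      \<Longrightarrow> (\<Sum>i\<in>I. norm (g (u i) - g (l i))) < e / 2"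
      using absolutely_continuous_on_finite_family[OF AC half_gt_zero[OF \<open>e > 0\<close>]] by blast
    obtain U where U: "open U" "E \<subseteq> U" "emeasure lborel U < ennreal \<delta>"
    proof -
      have E0: "E \<in> null_sets lebesgue" using E by (simp add: negligible_iff_null_sets)
      then have "E \<in> sets lebesgue" by auto
      then obtain U where U: "open U" "E \<subseteq> U" "U - E \<in> lmeasurable"
          "emeasure lebesgue (U - E) < ennreal \<delta>"
        by (rule sets_lebesgue_outer_open[OF _ \<open>\<delta> > 0\<close>])
      have "emeasure lebesgue (U - E) = emeasure lebesgue U"
        using E0 U(1) by (intro emeasure_Diff_null_set) auto
      then show ?thesis using U that by auto
    qed
    have "\<exists>r>0. (t \<in> E \<longrightarrow> ball t r \<subseteq> U) \<and>
        (t \<in> {a..b} - E \<longrightarrow> (\<forall>y\<in>{a..b}. \<bar>y - t\<bar> < r \<longrightarrow>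
            norm (g y - g t - (y - t) *\<^sub>R q t) \<le> e1 * \<bar>y - t\<bar>))" for t
    proof (cases "t \<in> E")
      case True
      then obtain r where "r > 0" "ball t r \<subseteq> U" using U openE by blast
      with True show ?thesis by blast
    next
      case False
      show ?thesis
      proof (cases "t \<in> {a..b}")
        case True
        with False have "(g has_vector_derivative q t) (at t within {a..b})"
          by (intro deriv) auto
        then obtain d where "d > 0" "\<forall>y\<in>{a..b}. norm (y - t) < d \<longrightarrow>
            norm (g y - g t - (y - t) *\<^sub>R q t) \<le> e1 * norm (y - t)"
          using \<open>e1 > 0\<close> unfolding has_vector_derivative_def has_derivative_within_alt by blast
        with False show ?thesis unfolding real_norm_def by blast
      qed (use False in \<open>auto intro: exI[of _ 1]\<close>)
    qed
    then obtain r where r: "\<And>t. r t > 0" "\<And>t. t \<in> E \<Longrightarrow> ball t (r t) \<subseteq> U"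
      "\<And>t y. \<lbrakk>t \<in> {a..b}; t \<notin> E; y \<in> {a..b}; \<bar>y - t\<bar> < r t\<rbrakk> \<Longrightarrow>
            norm (g y - g t - (y - t) *\<^sub>R q t) \<le> e1 * \<bar>y - t\<bar>"
      using choice[OF allI, of "\<lambda>t r. r > 0 \<and> (t \<in> E \<longrightarrow> ball t r \<subseteq> U) \<and>
        (t \<in> {a..b} - E \<longrightarrow> (\<forall>y\<in>{a..b}. \<bar>y - t\<bar> < r \<longrightarrow>
            norm (g y - g t - (y - t) *\<^sub>R q t) \<le> e1 * \<bar>y - t\<bar>))"] by blast
    have "norm ((\<Sum>(x, k)\<in>p. measure lborel k *\<^sub>R q0 x) - (g b - g a)) < e"
      if p: "p tagged_division_of {a..b}" and fine: "(\<lambda>t. ball t (r t)) fine p" for p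
    proof -
      have fin: "finite p" using p by blast
      define l where "l i = Inf (snd i)" for i :: "real \<times> real set"
      define u where "u i = Sup (snd i)" for i :: "real \<times> real set"
      have k: "snd i = {l i..u i} \<and> a \<le> l i \<and> l i \<le> fst i \<and> fst i \<le> u i \<and> u i \<le> b
          \<and> {l i..u i} \<subseteq> ball (fst i) (r (fst i))" if i: "i \<in> p" for i
      proof -
        obtain x K where [simp]: "i = (x, K)" by force
        have xK: "(x, K) \<in> p" using i by simp
        obtain c d where K: "K = {c..d}" "x \<in> K" "K \<subseteq> {a..b}"
          using tagged_division_ofD(2-4)[OF p xK] by auto
        then have "c \<le> d" by auto
        moreover have "K \<subseteq> ball x (r x)" using fine i by (auto simp: fine_def)
        ultimately show ?thesis using K by (auto simp: l_def u_def)
      qed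
      have k_le: "a \<le> l i \<and> l i \<le> u i \<and> u i \<le> b" if "i \<in> p" for i
        using k[OF that] by linarith
      have cont: "measure lborel (snd i) = u i - l i" if "i \<in> p" for i
        using k[OF that] by auto
      have disj: "disjoint_family_on (\<lambda>i. {l i<..<u i}) p"
        unfolding disjoint_family_on_def
      proof (intro ballI impI)
        fix i j assume ij: "i \<in> p" "j \<in> p" "i \<noteq> j"
        then have "interior (snd i) \<inter> interior (snd j) = {}"
          using tagged_division_ofD(5)[OF p, of "fst i" "snd i" "fst j" "snd j"] by simp
        moreover have "interior (snd i) = {l i<..<u i}" "interior (snd j) = {l j<..<u j}"
          using k[OF ij(1)] k[OF ij(2)] interior_atLeastAtMost_real by simp_all
        ultimately show "{l i<..<u i} \<inter> {l j<..<u j} = {}"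
          by simp
      qed
      define B where "B = {i \<in> p. fst i \<in> E}"
      have "norm ((\<Sum>(x, k)\<in>p. measure lborel k *\<^sub>R q0 x) - (g b - g a)) =
          norm (\<Sum>i\<in>p. (u i - l i) *\<^sub>R q0 (fst i) - (g (u i) - g (l i)))"
      proof -
        have "(\<Sum>(x, k)\<in>p. g (Sup k) - g (Inf k)) = g b - g a"
          using additive_tagged_division_1[OF \<open>a \<le> b\<close> p] .
        then show ?thesis
          using cont by (simp add: sum_subtractf case_prod_unfold u_def l_def)
      qed
      also have "\<dots> \<le> (\<Sum>i\<in>p. norm ((u i - l i) *\<^sub>R q0 (fst i) - (g (u i) - g (l i))))"
        by (rule norm_sum)
      also have "\<dots> = (\<Sum>i\<in>B. norm ((u i - l i) *\<^sub>R q0 (fst i) - (g (u i) - g (l i)))) +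
          (\<Sum>i\<in>p - B. norm ((u i - l i) *\<^sub>R q0 (fst i) - (g (u i) - g (l i))))"
        by (subst sum.subset_diff[of B p]) (use fin in \<open>auto simp: B_def\<close>)
      also have "(\<Sum>i\<in>B. norm ((u i - l i) *\<^sub>R q0 (fst i) - (g (u i) - g (l i)))) =
          (\<Sum>i\<in>B. norm (g (u i) - g (l i)))"
        by (intro sum.cong) (auto simp: B_def q0_def norm_minus_commute)
      also have "\<dots> < e / 2"
      proof (rule \<delta>)
        show "finite B" using fin by (auto simp: B_def)
        show "a \<le> l i \<and> l i \<le> u i \<and> u i \<le> b" if "i \<in> B" for i
          using k_le[of i] that by (simp add: B_def)
        show disjB: "disjoint_family_on (\<lambda>i. {l i<..<u i}) B"
          using disj by (auto simp: B_def disjoint_family_on_def)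
        have "ennreal (\<Sum>i\<in>B. u i - l i) \<le> emeasure lborel U"
        proof (rule sum_lengths_le_emeasure[OF \<open>finite B\<close> _ disjB _ \<open>open U\<close>])
          fix i assume "i \<in> B"
          then have "i \<in> p" "fst i \<in> E" by (auto simp: B_def)
          then show "l i \<le> u i" "{l i<..<u i} \<subseteq> U"
            using k_le[of i] k[of i] r(2)[of "fst i"] greaterThanLessThan_subseteq_atLeastAtMost_iff[of "l i" "u i" "l i" "u i"]
            by (simp, meson order.trans order.refl)
        qed
        also note U(3)
        finally show "(\<Sum>i\<in>B. u i - l i) < \<delta>"
          by (rule contrapos_pp) (simp add: not_less ennreal_leI)
      qed
      also have "(\<Sum>i\<in>p - B. norm ((u i - l i) *\<^sub>R q0 (fst i) - (g (u i) - g (l i)))) \<le>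
          (\<Sum>i\<in>p - B. e1 * (u i - l i))"
      proof (rule sum_mono)
        fix i assume "i \<in> p - B"
        then have i: "i \<in> p" "fst i \<notin> E" by (auto simp: B_def)
        let ?x = "fst i"
        note ki = k[OF i(1)]
        have "norm (g (u i) - g ?x - (u i - ?x) *\<^sub>R q ?x) \<le> e1 * \<bar>u i - ?x\<bar>"
          "norm (g (l i) - g ?x - (l i - ?x) *\<^sub>R q ?x) \<le> e1 * \<bar>l i - ?x\<bar>"
          using ki i(2) by (intro r(3); force simp: subset_iff dist_real_def)+
        then have "norm ((g (l i) - g ?x - (l i - ?x) *\<^sub>R q ?x) - (g (u i) - g ?x - (u i - ?x) *\<^sub>R q ?x))
            \<le> e1 * \<bar>l i - ?x\<bar> + e1 * \<bar>u i - ?x\<bar>"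
          by (intro order_trans[OF norm_triangle_ineq4]) auto
        also have "\<dots> = e1 * (u i - l i)"
          using ki by (simp add: algebra_simps)
        also have "(g (l i) - g ?x - (l i - ?x) *\<^sub>R q ?x) - (g (u i) - g ?x - (u i - ?x) *\<^sub>R q ?x) =
            (u i - l i) *\<^sub>R q0 ?x - (g (u i) - g (l i))"
          using i(2) by (simp add: q0_def algebra_simps)
        finally show "norm ((u i - l i) *\<^sub>R q0 ?x - (g (u i) - g (l i))) \<le> e1 * (u i - l i)" .
      qed
      also have "\<dots> \<le> (\<Sum>i\<in>p. e1 * (u i - l i))"
        by (rule sum_mono2) (use fin k_le \<open>e1 > 0\<close> in \<open>auto intro!: mult_nonneg_nonneg\<close>)
      also have "\<dots> = e1 * (b - a)"
        using additive_tagged_division_1[OF \<open>a \<le> b\<close> p, of "\<lambda>x. x"]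
        by (simp add: sum_distrib_left[symmetric] case_prod_unfold u_def l_def)
      also note e1
      finally show ?thesis by simp
    qed
    then show "\<exists>\<gamma>. gauge \<gamma> \<and> (\<forall>\<D>. \<D> tagged_division_of {a..b} \<and> \<gamma> fine \<D> \<longrightarrow>
        norm ((\<Sum>(x, k)\<in>\<D>. measure lborel k *\<^sub>R q0 x) - (g b - g a)) < e)"
      using r(1) by (intro exI[of _ "\<lambda>t. ball t (r t)"]) (auto simp: gauge_def)
  qed
  then show ?thesis
    by (rule has_integral_spike[OF E, rotated]) (auto simp: q0_def)
qed

lemma absolutely_continuous_on_subinterval:
  assumes "absolutely_continuous_on a b g" "a \<le> c" "d \<le> b"
  shows "absolutely_continuous_on c d g"
  unfolding absolutely_continuous_on_def
proof (intro allI impI)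
  fix \<epsilon> :: real assume "\<epsilon> > 0"
  obtain \<delta> where "\<delta> > 0" and \<delta>: "\<And>(I :: nat set) l u. \<lbrakk>finite I; \<And>i. i \<in> I \<Longrightarrow> a \<le> l i \<and> l i \<le> u i \<and> u i \<le> b;
        disjoint_family_on (\<lambda>i. {l i<..<u i}) I; (\<Sum>i\<in>I. u i - l i) < \<delta>\<rbrakk>
      \<Longrightarrow> (\<Sum>i\<in>I. norm (g (u i) - g (l i))) < \<epsilon>"
    by (rule absolutely_continuous_on_finite_family[OF assms(1) \<open>\<epsilon> > 0\<close>]) blast
  have "(\<Sum>i<n. norm (g (u i) - g (l i))) < \<epsilon>"
    if "\<forall>i<n. c \<le> l i \<and> l i \<le> u i \<and> u i \<le> d" "disjoint_family_on (\<lambda>i. {l i<..<u i}) {..<n}"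
      "(\<Sum>i<n. u i - l i) < \<delta>" for n :: nat and l u
    by (rule \<delta>) (use that assms(2,3) in force)+
  then show "\<exists>\<delta>>0. \<forall>(n::nat) l u. (\<forall>i<n. c \<le> l i \<and> l i \<le> u i \<and> u i \<le> d) \<longrightarrow>
      disjoint_family_on (\<lambda>i. {l i<..<u i}) {..<n} \<longrightarrow> (\<Sum>i<n. u i - l i) < \<delta> \<longrightarrow>
      (\<Sum>i<n. norm (g (u i) - g (l i))) < \<epsilon>"
    using \<open>\<delta> > 0\<close> by blast
qed

text \<open>
  The gauge integral of the preceding theorem is upgraded to a Lebesgue integral: a gauge integrable
  function is measurable, and the integrable majorant \<open>C t\<^sup>\<eta>\<^sup>-\<^sup>1\<close> then gives absolute
  integrability.
\<close>

lemma absolutely_continuous_primitive: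
  fixes g q :: "real \<Rightarrow> complex"
  assumes "T > 0" and AC: "absolutely_continuous_on 0 T g" and "g 0 = 0"
    and deriv: "AE t in lebesgue. t \<in> {0<..<T} \<longrightarrow> (g has_vector_derivative q t) (at t)"
    and bound: "\<exists>C>0. \<exists>\<eta>>0. AE t in lebesgue. t \<in> {0<..<T} \<longrightarrow> norm (q t) \<le> C * t powr (\<eta> - 1)"
  shows "\<And>x. x \<in> {0..T} \<Longrightarrow> (q has_integral g x) {0..x}" and "set_integrable lebesgue {0<..<T} q"
proof -
  obtain C \<eta> where "C > 0" "\<eta> > 0"
    and C: "AE t in lebesgue. t \<in> {0<..<T} \<longrightarrow> norm (q t) \<le> C * t powr (\<eta> - 1)"
    using bound by blast
  have "AE t in lebesgue. t \<in> {0<..<T} \<longrightarrow> (g has_vector_derivative q t) (at t) \<and> norm (q t) \<le> C * t powr (\<eta> - 1)"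
    using deriv C by eventually_elim auto
  then obtain N0 where N0: "N0 \<in> null_sets lebesgue"
    "{t. \<not> (t \<in> {0<..<T} \<longrightarrow> (g has_vector_derivative q t) (at t) \<and> norm (q t) \<le> C * t powr (\<eta> - 1))} \<subseteq> N0"
    by (auto simp: eventually_ae_filter)
  define E where "E = N0 \<union> {0, T}"
  have E: "negligible E"
    using N0(1) by (auto simp: E_def negligible_iff_null_sets[symmetric] intro!: negligible_Un)
  have good: "(g has_vector_derivative q t) (at t) \<and> norm (q t) \<le> C * t powr (\<eta> - 1)"
    if "t \<in> {0..T} - E" for t
  proof -
    have "t \<noteq> 0" "t \<noteq> T" "t \<notin> N0" using that by (auto simp: E_def)
    with that have "t \<in> {0<..<T}" by auto
    with \<open>t \<notin> N0\<close> N0(2) show ?thesis by blast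
  qed
  show int: "(q has_integral g x) {0..x}" if x: "x \<in> {0..T}" for x
  proof -
    have "(q has_integral g x - g 0) {0..x}"
    proof (rule absolutely_continuous_has_integral[OF _ _ E])
      show "absolutely_continuous_on 0 x g"
        by (rule absolutely_continuous_on_subinterval[OF AC]) (use x in auto)
      show "(g has_vector_derivative q t) (at t within {0..x})" if "t \<in> {0..x} - E" for t
        using good[of t] that x by (auto intro: has_vector_derivative_at_within)
    qed (use x in auto)
    then show ?thesis using \<open>g 0 = 0\<close> by simp
  qed
  define q1 where "q1 t = (if t \<in> E then 0 else q t)" for t
  have "q1 absolutely_integrable_on {0..T}"
  proof (rule absolutely_integrable_integrable_bound[where g = "\<lambda>t. C * t powr (\<eta> - 1)"])
    show "norm (q1 t) \<le> C * t powr (\<eta> - 1)" if "t \<in> {0..T}" for t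
      using good[of t] that \<open>C > 0\<close> by (auto simp: q1_def)
    have "(q1 has_integral g T) {0..T}"
      by (rule has_integral_spike[OF E _ int]) (use \<open>T > 0\<close> in \<open>auto simp: q1_def\<close>)
    then show "q1 integrable_on {0..T}" by blast
    show "(\<lambda>t. C * t powr (\<eta> - 1)) integrable_on {0..T}"
      using integrable_cmul[OF integrable_on_powr_from_0[of "\<eta> - 1" T], of C] \<open>\<eta> > 0\<close> \<open>T > 0\<close> by simp
  qed
  then have "q absolutely_integrable_on {0..T}"
    by (rule absolutely_integrable_spike[OF _ E]) (simp add: q1_def)
  then show "set_integrable lebesgue {0<..<T} q"
    by (rule set_integrable_subset) auto
qed

section \<open>Borel representatives\<close>

text \<open>
  The passage from the integrals of the problem to integrals of Borel functions over the whole line.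
  Since Lebesgue measure is complete, \<open>F\<close> inherits its measurability on \<open>A\<close> from \<open>F'\<close>.
\<close>

lemma set_lebesgue_integral_eq_lborel:
  fixes F F' :: "real \<Rightarrow> complex"
  assumes [measurable]: "F' \<in> borel_measurable borel"
    and eq: "AE s in lborel. s \<in> A \<longrightarrow> F s = F' s" and zero: "\<And>s. s \<notin> A \<Longrightarrow> F' s = 0"
  shows "(LINT s:A|lebesgue. F s) = (\<integral>s. F' s \<partial>lborel)"
proof -
  have ae: "AE s in lebesgue. F' s = indicator A s *\<^sub>R F s"
  proof (rule AE_completion)
    show "AE s in lborel. F' s = indicator A s *\<^sub>R F s"
      using eq by eventually_elim (auto simp: indicator_def zero)
  qed
  have F': "F' \<in> borel_measurable lebesgue"
    by (rule measurable_completion) simp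
  have "(\<integral>s. indicator A s *\<^sub>R F s \<partial>lebesgue) = (\<integral>s. F' s \<partial>lebesgue)"
    by (rule integral_cong_AE) (use borel_measurable_AE[OF F' ae] F' ae in \<open>auto elim: AE_mp\<close>)
  also have "\<dots> = (\<integral>s. F' s \<partial>lborel)"
    by (rule integral_completion) simp
  finally show ?thesis by (simp add: set_lebesgue_integral_def)
qed

lemma AE_lborel_real_affine:
  fixes P :: "real \<Rightarrow> bool"
  assumes "AE x in lborel. P x" "c \<noteq> 0"
  shows "AE x in lborel. P (t + c * x)"
proof -
  obtain N where N: "N \<in> null_sets lborel" "{x. \<not> P x} \<subseteq> N"
    using assms(1) by (auto simp: eventually_ae_filter)
  then have [measurable]: "N \<in> sets borel" by auto
  have "AE x in lborel. x \<notin> N"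
    using N(1) by (rule AE_not_in)
  then have "AE x in lborel. t + c * x \<notin> N"
    by (intro AE_borel_affine[of c "\<lambda>x. x \<notin> N"] \<open>c \<noteq> 0\<close>) auto
  then show ?thesis
    by eventually_elim (use N(2) in auto)
qed

lemma AE_lborel_reflect:
  fixes P :: "real \<Rightarrow> bool"
  assumes "AE x in lborel. P x" shows "AE x in lborel. P (t - x)"
  using AE_lborel_real_affine[OF assms, of "-1" t] by simp

lemma AE_lborel_translate:
  fixes P :: "real \<Rightarrow> bool"
  assumes "AE x in lborel. P x" shows "AE x in lborel. P (x - t)"
  using AE_lborel_real_affine[OF assms, of 1 "-t"] by simp

lemma borel_representative:
  fixes f :: "real \<Rightarrow> complex"
  assumes f: "set_integrable lebesgue {0<..<T} f"
  obtains f' where "integrable lborel f'" "\<And>x. x \<notin> {0<..<T} \<Longrightarrow> f' x = 0"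
    "AE x in lborel. x \<in> {0<..<T} \<longrightarrow> f' x = f x"
proof -
  define h where "h x = indicator {0<..<T} x *\<^sub>R f x" for x
  have h: "integrable lebesgue h"
    using f by (simp add: set_integrable_def h_def[abs_def])
  then have hm: "h \<in> borel_measurable lebesgue" by auto
  then have "(\<lambda>x. Re (h x)) \<in> borel_measurable lebesgue" "(\<lambda>x. Im (h x)) \<in> borel_measurable lebesgue"
    by simp_all
  then obtain a b where [measurable]: "a \<in> borel_measurable lborel" "b \<in> borel_measurable lborel"
    and ab: "AE x in lborel. Re (h x) = a x" "AE x in lborel. Im (h x) = b x"
    by (blast dest: completion_ex_borel_measurable_real)
  define f' where "f' x = indicator {0<..<T} x *\<^sub>R (of_real (a x) + \<i> * of_real (b x))" for x
  have [measurable]: "f' \<in> borel_measurable borel"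
    unfolding f'_def by measurable
  have eq: "AE x in lborel. f' x = h x"
    using ab by eventually_elim (auto simp: f'_def h_def complex_eq_iff split: split_indicator)
  have f'm: "f' \<in> borel_measurable lebesgue"
    by (rule measurable_completion) simp
  show thesis
  proof
    have "integrable lebesgue f'"
      using h by (rule Bochner_Integration.integrable_cong_AE_imp)
        (use f'm eq in \<open>auto simp: eq_commute AE_completion\<close>)
    then show "integrable lborel f'"
      by (simp add: integrable_completion)
    show "f' x = 0" if "x \<notin> {0<..<T}" for x
      using that by (simp add: f'_def)
    show "AE x in lborel. x \<in> {0<..<T} \<longrightarrow> f' x = f x"
      using eq by eventually_elim (auto simp: h_def)
  qed
qed

section \<open>Volterra kernels and the Neumann series\<close>

definition kernel_op :: "(real \<Rightarrow> real \<Rightarrow> complex) \<Rightarrow> (real \<Rightarrow> complex) \<Rightarrow> real \<Rightarrow> complex" where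
  "kernel_op G v t = (\<integral>s. G t s * v s \<partial>lborel)"

text \<open>
  The Borel counterpart of \<open>iterated_kernel\<close>, with the same shifted numbering. The integral extends
  over the whole line because it is used for kernels that vanish off the triangle
  \<open>0 \<le> s < t \<le> T\<close>.
\<close>

primrec kernel_power :: "(real \<Rightarrow> real \<Rightarrow> complex) \<Rightarrow> nat \<Rightarrow> real \<Rightarrow> real \<Rightarrow> complex" where
  "kernel_power G 0 = G"
| "kernel_power G (Suc n) = (\<lambda>t s. \<integral>\<xi>. G t \<xi> * kernel_power G n \<xi> s \<partial>lborel)"

definition neumann_kernel :: "(real \<Rightarrow> real \<Rightarrow> complex) \<Rightarrow> real \<Rightarrow> real \<Rightarrow> complex" where
  "neumann_kernel G t s = (\<Sum>n. (-1) ^ n * kernel_power G n t s)"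

lemma kernel_section_measurable:
  fixes G :: "real \<Rightarrow> real \<Rightarrow> complex"
  assumes "case_prod G \<in> borel_measurable (borel \<Otimes>\<^sub>M borel)"
  shows "G t \<in> borel_measurable borel" "(\<lambda>t. G t s) \<in> borel_measurable borel"
proof -
  show "G t \<in> borel_measurable borel"
    using measurable_compose[OF measurable_Pair1' assms, of t] by simp
  show "(\<lambda>t. G t s) \<in> borel_measurable borel"
    using measurable_compose[OF measurable_Pair2' assms, of s] by simp
qed

lemma borel_measurable_kernel_op:
  assumes [measurable]: "case_prod G \<in> borel_measurable (borel \<Otimes>\<^sub>M borel)" "v \<in> borel_measurable borel"
  shows "kernel_op G v \<in> borel_measurable borel"
proof -
  have "(\<lambda>t. \<integral>s. case_prod G (t, s) * v s \<partial>lborel) \<in> borel_measurable borel"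
    by measurable
  then show ?thesis by (simp add: kernel_op_def[abs_def])
qed

text \<open>
  The one use of Fubini's theorem behind associativity of convolution, the kernel of the memory term and
  the composition of iterated kernels. The hypotheses make the double integral absolutely convergent
  for the given \<open>t\<close>, so the identity holds for each \<open>t\<close> and not merely almost everywhere.
\<close>

lemma kernel_op_comp:
  assumes Gm [measurable]: "case_prod G \<in> borel_measurable (borel \<Otimes>\<^sub>M borel)"
    and Hm [measurable]: "case_prod H \<in> borel_measurable (borel \<Otimes>\<^sub>M borel)"
    and vm [measurable]: "v \<in> borel_measurable borel"
    and G: "integrable lborel (G t)" and H: "\<And>\<xi>. integrable lborel (H \<xi>)"
    and b: "\<And>\<xi>. (\<integral>s. norm (H \<xi> s) \<partial>lborel) \<le> b" and B: "\<And>s. norm (v s) \<le> B"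
  shows "kernel_op G (kernel_op H v) t = kernel_op (\<lambda>t s. \<integral>\<xi>. G t \<xi> * H \<xi> s \<partial>lborel) v t"
proof -
  have [measurable]: "G t \<in> borel_measurable borel" for t
    by (rule kernel_section_measurable[OF Gm])
  have [measurable]: "H t \<in> borel_measurable borel" for t
    by (rule kernel_section_measurable[OF Hm])
  have "B \<ge> 0" using B norm_ge_zero order_trans by blast
  define F where "F \<xi> s = G t \<xi> * (case_prod H (\<xi>, s) * v s)" for \<xi> s
  have [measurable]: "case_prod F \<in> borel_measurable (lborel \<Otimes>\<^sub>M lborel)"
    unfolding F_def by measurable
  have inner: "(\<integral>\<^sup>+s. norm (H \<xi> s) \<partial>lborel) \<le> ennreal b" for \<xi>
    using nn_integral_eq_integral[OF integrable_norm[OF H[of \<xi>]]] b[of \<xi>] by (simp add: ennreal_leI)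
  have "integrable (lborel \<Otimes>\<^sub>M lborel) (case_prod F)"
  proof (rule integrableI_bounded)
    have "(\<integral>\<^sup>+z. norm (case_prod F z) \<partial>(lborel \<Otimes>\<^sub>M lborel)) = (\<integral>\<^sup>+\<xi>. \<integral>\<^sup>+s. norm (F \<xi> s) \<partial>lborel \<partial>lborel)"
      by (subst lborel.nn_integral_fst[symmetric]) auto
    also have "\<dots> \<le> (\<integral>\<^sup>+\<xi>. ennreal (norm (G t \<xi>)) * (ennreal B * ennreal b) \<partial>lborel)"
    proof (rule nn_integral_mono)
      fix \<xi>
      have "(\<integral>\<^sup>+s. norm (F \<xi> s) \<partial>lborel) \<le>
          (\<integral>\<^sup>+s. ennreal (norm (G t \<xi>)) * (ennreal B * ennreal (norm (H \<xi> s))) \<partial>lborel)"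
      proof (rule nn_integral_mono)
        fix s
        have "norm (F \<xi> s) \<le> norm (G t \<xi>) * (B * norm (H \<xi> s))"
          using B[of s] by (auto simp: F_def norm_mult mult.commute[of "norm (H \<xi> s)"] intro!: mult_left_mono mult_right_mono)
        then show "ennreal (norm (F \<xi> s)) \<le> ennreal (norm (G t \<xi>)) * (ennreal B * ennreal (norm (H \<xi> s)))"
          using \<open>B \<ge> 0\<close> by (simp add: ennreal_mult[symmetric] ennreal_leI)
      qed
      also have "\<dots> = ennreal (norm (G t \<xi>)) * (ennreal B * (\<integral>\<^sup>+s. norm (H \<xi> s) \<partial>lborel))"
        by (simp add: nn_integral_cmult)
      also have "\<dots> \<le> ennreal (norm (G t \<xi>)) * (ennreal B * ennreal b)"
        by (intro mult_left_mono inner) auto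
      finally show "(\<integral>\<^sup>+s. norm (F \<xi> s) \<partial>lborel) \<le> ennreal (norm (G t \<xi>)) * (ennreal B * ennreal b)" .
    qed
    also have "\<dots> = (\<integral>\<^sup>+\<xi>. norm (G t \<xi>) \<partial>lborel) * (ennreal B * ennreal b)"
      by (simp add: nn_integral_multc)
    also have "\<dots> < \<infinity>"
      using nn_integral_eq_integral[OF integrable_norm[OF G]]
      by (simp add: ennreal_mult_less_top)
    finally show "(\<integral>\<^sup>+z. norm (case_prod F z) \<partial>(lborel \<Otimes>\<^sub>M lborel)) < \<infinity>" .
  qed simp
  then have "(\<integral>s. (\<integral>\<xi>. F \<xi> s \<partial>lborel) \<partial>lborel) = (\<integral>\<xi>. (\<integral>s. F \<xi> s \<partial>lborel) \<partial>lborel)"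
    by (rule lborel_pair.Fubini_integral)
  moreover have "(\<integral>s. F \<xi> s \<partial>lborel) = G t \<xi> * kernel_op H v \<xi>" for \<xi>
    by (simp add: F_def kernel_op_def)
  moreover have "(\<integral>\<xi>. F \<xi> s \<partial>lborel) = (\<integral>\<xi>. G t \<xi> * H \<xi> s \<partial>lborel) * v s" for s
    by (simp add: F_def flip: mult.assoc)
  ultimately show ?thesis
    by (simp add: kernel_op_def)
qed

text \<open>
  Iterated kernels may fail to be integrable at individual points. The Bochner integral is \<open>0\<close> there by
  convention, so the estimate holds trivially at those points.
\<close>

lemma norm_integral_le_nn_integral:
  "ennreal (norm (\<integral>x. f x \<partial>M)) \<le> (\<integral>\<^sup>+x. norm (f x :: complex) \<partial>M)"
  by (cases "integrable M f") (simp_all add: integral_norm_bound_ennreal not_integrable_integral_eq)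

lemma norm_kernel_op_le:
  assumes "integrable lborel (G t)" "v \<in> borel_measurable borel" "\<And>s. norm (v s) \<le> B"
  shows "integrable lborel (\<lambda>s. G t s * v s)"
    and "norm (kernel_op G v t) \<le> (\<integral>s. norm (G t s) \<partial>lborel) * B"
proof -
  have [measurable]: "G t \<in> borel_measurable borel" "v \<in> borel_measurable borel" using assms by auto
  have le: "norm (G t s * v s) \<le> norm (G t s) * B" for s
    using assms(3)[of s] by (simp add: norm_mult mult_left_mono)
  have i: "integrable lborel (\<lambda>s. norm (G t s) * B)" using assms(1) by simp
  show 1: "integrable lborel (\<lambda>s. G t s * v s)"
    by (rule Bochner_Integration.integrable_bound[OF i])
       (use le in \<open>auto intro!: AE_I2 intro: order_trans[OF _ abs_ge_self]\<close>)
  have "norm (kernel_op G v t) \<le> (\<integral>s. norm (G t s * v s) \<partial>lborel)"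
    unfolding kernel_op_def by (rule integral_norm_bound)
  also have "\<dots> \<le> (\<integral>s. norm (G t s) * B \<partial>lborel)"
    by (rule integral_mono) (use 1 i le in auto)
  finally show "norm (kernel_op G v t) \<le> (\<integral>s. norm (G t s) \<partial>lborel) * B" by simp
qed

text \<open>
  The Laplace transform of an integrable function vanishes at infinity. The factor \<open>1/2\<close> is the
  contraction rate that replaces a smallness condition on the coefficients.
\<close>

lemma laplace_transform_small:
  fixes h :: "real \<Rightarrow> real"
  assumes h: "integrable lborel h"
  obtains \<mu> where "\<mu> \<ge> 0"
    "(\<integral>\<^sup>+x. ennreal (indicator {0<..} x * \<bar>h x\<bar> * exp (- \<mu> * x)) \<partial>lborel) \<le> ennreal (1/2)"
proof -
  have [measurable]: "h \<in> borel_measurable borel" using h by auto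
  define F where "F n x = indicator {0<..} x * \<bar>h x\<bar> * exp (- real n * x)" for n :: nat and x
  have F_le: "norm (F n x) \<le> \<bar>h x\<bar>" for n x
    by (auto simp: F_def indicator_def abs_mult intro!: mult_left_le)
  have int: "integrable lborel (F n)" for n
    by (rule Bochner_Integration.integrable_bound[OF h]) (use F_le in \<open>auto simp: F_def[abs_def]\<close>)
  have "(\<lambda>n. \<integral>x. F n x \<partial>lborel) \<longlonglongrightarrow> (\<integral>x. 0 \<partial>(lborel :: real measure))"
  proof (rule integral_dominated_convergence[where w = "\<lambda>x. \<bar>h x\<bar>"])
    show "AE x in lborel. (\<lambda>n. F n x) \<longlonglongrightarrow> 0"
    proof (rule AE_I2)
      fix x :: real
      show "(\<lambda>n. F n x) \<longlonglongrightarrow> 0"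
      proof (cases "x > 0")
        case True
        have "(\<lambda>n. exp (- x) ^ n) \<longlonglongrightarrow> 0"
          using True by (intro LIMSEQ_realpow_zero) auto
        then have "(\<lambda>n. \<bar>h x\<bar> * exp (- x) ^ n) \<longlonglongrightarrow> 0"
          by (rule tendsto_mult_right_zero)
        then show ?thesis
          using True by (simp add: F_def exp_of_nat_mult[symmetric])
      qed (simp add: F_def)
    qed
  qed (use h F_le in \<open>auto simp: F_def[abs_def]\<close>)
  then have "eventually (\<lambda>n. (\<integral>x. F n x \<partial>lborel) < 1/2) sequentially"
    by (intro order_tendstoD) auto
  then obtain n where n: "(\<integral>x. F n x \<partial>lborel) < 1/2"
    by (auto simp: eventually_sequentially)
  have "(\<integral>\<^sup>+x. ennreal (F n x) \<partial>lborel) = ennreal (\<integral>x. F n x \<partial>lborel)"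
    by (rule nn_integral_eq_integral[OF int]) (simp add: F_def)
  also have "\<dots> \<le> ennreal (1/2)"
    using n by (intro ennreal_leI) simp
  finally show thesis
    unfolding F_def by (intro that[of "real n"]) simp_all
qed

lemma summable_half_powers: "summable (\<lambda>n. C * (1/2 :: real) ^ n)"
  by (intro summable_mult summable_geometric) auto

text \<open>
  A weakly singular Volterra kernel in Borel form. Any integrable convolution majorant \<open>h\<close> is
  admissible, in particular a multiple of \<open>x\<^sup>\<eta>\<^sup>-\<^sup>1\<close> on \<open>(0,T)\<close>.
\<close>

locale volterra_kernel =
  fixes T :: real and h :: "real \<Rightarrow> real" and G :: "real \<Rightarrow> real \<Rightarrow> complex"
  assumes G_measurable [measurable]: "case_prod G \<in> borel_measurable (borel \<Otimes>\<^sub>M borel)"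
    and h_integrable: "integrable lborel h"
    and G_le: "norm (G t s) \<le> h (t - s)"
    and G_supp: "\<not> (0 \<le> s \<and> s < t \<and> t \<le> T) \<Longrightarrow> G t s = 0"
begin

abbreviation J where "J \<equiv> kernel_power G"

lemma power_measurable [measurable]: "case_prod (J n) \<in> borel_measurable (borel \<Otimes>\<^sub>M borel)"
proof (induction n)
  case (Suc n)
  note [measurable] = Suc
  have "(\<lambda>z. \<integral>\<xi>. case_prod G (fst z, \<xi>) * case_prod (J n) (\<xi>, snd z) \<partial>lborel)
      \<in> borel_measurable (borel \<Otimes>\<^sub>M borel)"
    by measurable
  then show ?case by (simp add: case_prod_unfold)
qed simp

lemma section_measurable [measurable]:
  "J n t \<in> borel_measurable borel" "(\<lambda>t. J n t s) \<in> borel_measurable borel"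
  by (rule kernel_section_measurable[OF power_measurable])+

lemma power_supp: "\<not> (0 \<le> s \<and> s < t \<and> t \<le> T) \<Longrightarrow> J n t s = 0"
proof (induction n arbitrary: t s)
  case (Suc n)
  have "G t \<xi> * J n \<xi> s = 0" for \<xi>
    using G_supp[of \<xi> t] Suc.IH[of s \<xi>] Suc.prems by fastforce
  then have "(\<lambda>\<xi>. G t \<xi> * J n \<xi> s) = (\<lambda>_. 0)" by (rule ext)
  then show ?case by (simp only: kernel_power.simps) simp
qed (use G_supp in auto)

text \<open>
  Because \<open>exp(-\<mu> (t - s)) = exp(-\<mu> (t - \<xi>)) exp(-\<mu> (\<xi> - s))\<close>, the weighted row integrals are
  submultiplicative under composition of kernels, so it suffices to make the first one at most
  \<open>1/2\<close>.
\<close>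

lemma weighted_power_bound:
  obtains \<mu> where "\<mu> \<ge> 0"
    "\<And>n t. (\<integral>\<^sup>+s. ennreal (norm (J n t s) * exp (- \<mu> * (t - s))) \<partial>lborel) \<le> ennreal ((1/2) ^ Suc n)"
proof -
  have [measurable]: "h \<in> borel_measurable borel" using h_integrable by auto
  obtain \<mu> where "\<mu> \<ge> 0" and \<mu>:
    "(\<integral>\<^sup>+x. ennreal (indicator {0<..} x * \<bar>h x\<bar> * exp (- \<mu> * x)) \<partial>lborel) \<le> ennreal (1/2)"
    by (rule laplace_transform_small[OF h_integrable])
  have base: "(\<integral>\<^sup>+s. ennreal (norm (G t s) * exp (- \<mu> * (t - s))) \<partial>lborel) \<le> ennreal (1/2)" for t
  proof -
    have "(\<integral>\<^sup>+s. ennreal (norm (G t s) * exp (- \<mu> * (t - s))) \<partial>lborel) \<le>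
        (\<integral>\<^sup>+s. ennreal (indicator {0<..} (t - s) * \<bar>h (t - s)\<bar> * exp (- \<mu> * (t - s))) \<partial>lborel)"
    proof (intro nn_integral_mono ennreal_leI mult_right_mono)
      fix s
      show "norm (G t s) \<le> indicator {0<..} (t - s) * \<bar>h (t - s)\<bar>"
        using G_le[of t s] G_supp[of s t] by (cases "s < t") auto
    qed auto
    also have "\<dots> = (\<integral>\<^sup>+x. ennreal (indicator {0<..} x * \<bar>h x\<bar> * exp (- \<mu> * x)) \<partial>lborel)"
      by (subst (2) nn_integral_real_affine[where c = "-1" and t = t]) auto
    finally show ?thesis using \<mu> by (rule order_trans)
  qed
  have "(\<integral>\<^sup>+s. ennreal (norm (J n t s) * exp (- \<mu> * (t - s))) \<partial>lborel) \<le> ennreal ((1/2) ^ Suc n)" for n t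
  proof (induction n arbitrary: t)
    case 0
    show ?case using base by simp
  next
    case (Suc n)
    define a where "a \<xi> = ennreal (norm (G t \<xi>) * exp (- \<mu> * (t - \<xi>)))" for \<xi>
    define b where "b \<xi> s = ennreal (norm (case_prod (J n) (\<xi>, s)) * exp (- \<mu> * (\<xi> - s)))" for \<xi> s
    have [measurable]: "G t \<in> borel_measurable borel"
      using section_measurable(1)[of 0 t] by simp
    have [measurable]: "a \<in> borel_measurable borel" unfolding a_def by measurable
    have [measurable]: "case_prod b \<in> borel_measurable (borel \<Otimes>\<^sub>M borel)" unfolding b_def by measurable
    have [measurable]: "b \<xi> \<in> borel_measurable borel" for \<xi> unfolding b_def by simp
    have "(\<integral>\<^sup>+s. ennreal (norm (J (Suc n) t s) * exp (- \<mu> * (t - s))) \<partial>lborel)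
        \<le> (\<integral>\<^sup>+s. \<integral>\<^sup>+\<xi>. a \<xi> * b \<xi> s \<partial>lborel \<partial>lborel)"
    proof (rule nn_integral_mono)
      fix s
      have "ennreal (norm (J (Suc n) t s) * exp (- \<mu> * (t - s))) =
          ennreal (norm (J (Suc n) t s)) * ennreal (exp (- \<mu> * (t - s)))"
        by (simp add: ennreal_mult)
      also have "\<dots> \<le> (\<integral>\<^sup>+\<xi>. norm (G t \<xi> * J n \<xi> s) \<partial>lborel) * ennreal (exp (- \<mu> * (t - s)))"
        by (intro mult_right_mono) (simp_all add: norm_integral_le_nn_integral)
      also have "\<dots> = (\<integral>\<^sup>+\<xi>. ennreal (norm (G t \<xi> * J n \<xi> s)) * ennreal (exp (- \<mu> * (t - s))) \<partial>lborel)"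
        by (rule nn_integral_multc[symmetric]) measurable
      also have "\<dots> = (\<integral>\<^sup>+\<xi>. a \<xi> * b \<xi> s \<partial>lborel)"
        by (rule nn_integral_cong)
           (simp add: a_def b_def norm_mult ennreal_mult[symmetric] exp_add[symmetric] algebra_simps
              mult_exp_exp)
      finally show "ennreal (norm (J (Suc n) t s) * exp (- \<mu> * (t - s))) \<le> (\<integral>\<^sup>+\<xi>. a \<xi> * b \<xi> s \<partial>lborel)" .
    qed
    also have "\<dots> = (\<integral>\<^sup>+\<xi>. \<integral>\<^sup>+s. a \<xi> * b \<xi> s \<partial>lborel \<partial>lborel)"
      by (rule lborel_pair.Fubini') measurable
    also have "\<dots> = (\<integral>\<^sup>+\<xi>. a \<xi> * (\<integral>\<^sup>+s. b \<xi> s \<partial>lborel) \<partial>lborel)"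
      by (intro nn_integral_cong nn_integral_cmult) measurable
    also have "\<dots> \<le> (\<integral>\<^sup>+\<xi>. a \<xi> * ennreal ((1/2) ^ Suc n) \<partial>lborel)"
      by (intro nn_integral_mono mult_left_mono) (use Suc.IH in \<open>auto simp: b_def\<close>)
    also have "\<dots> = (\<integral>\<^sup>+\<xi>. a \<xi> \<partial>lborel) * ennreal ((1/2) ^ Suc n)"
      by (rule nn_integral_multc) measurable
    also have "\<dots> \<le> ennreal (1/2) * ennreal ((1/2) ^ Suc n)"
      by (intro mult_right_mono) (use base in \<open>auto simp: a_def\<close>)
    also have "\<dots> = ennreal ((1/2) ^ Suc (Suc n))"
      by (subst ennreal_mult[symmetric]) simp_all
    finally show ?case .
  qed
  with \<open>\<mu> \<ge> 0\<close> show thesis by (rule that)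
qed

lemma power_L1_bound:
  obtains A where "\<And>n t. integrable lborel (J n t)"
    "\<And>n t. (\<integral>s. norm (J n t s) \<partial>lborel) \<le> A * (1/2) ^ n" "A \<ge> 0"
proof -
  obtain \<mu> where "\<mu> \<ge> 0" and \<mu>:
    "\<And>n t. (\<integral>\<^sup>+s. ennreal (norm (J n t s) * exp (- \<mu> * (t - s))) \<partial>lborel) \<le> ennreal ((1/2) ^ Suc n)"
    by (rule weighted_power_bound) blast
  define A where "A = exp (\<mu> * \<bar>T\<bar>)"
  have nn: "(\<integral>\<^sup>+s. norm (J n t s) \<partial>lborel) \<le> ennreal (A * (1/2) ^ n)" for n t
  proof -
    have "(\<integral>\<^sup>+s. norm (J n t s) \<partial>lborel) \<le>
        (\<integral>\<^sup>+s. ennreal A * ennreal (norm (J n t s) * exp (- \<mu> * (t - s))) \<partial>lborel)"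
    proof (rule nn_integral_mono)
      fix s
      have "norm (J n t s) \<le> A * (norm (J n t s) * exp (- \<mu> * (t - s)))"
      proof (cases "0 \<le> s \<and> s < t \<and> t \<le> T")
        case True
        then have "\<mu> * (t - s) \<le> \<mu> * \<bar>T\<bar>" using \<open>\<mu> \<ge> 0\<close> by (intro mult_left_mono) auto
        then have "1 \<le> A * exp (- \<mu> * (t - s))"
          by (simp add: A_def mult_exp_exp)
        then show ?thesis
          using mult_left_mono[of 1 "A * exp (- \<mu> * (t - s))" "norm (J n t s)"] by (simp add: mult_ac)
      qed (simp add: power_supp)
      then show "ennreal (norm (J n t s)) \<le> ennreal A * ennreal (norm (J n t s) * exp (- \<mu> * (t - s)))"
        by (simp add: A_def ennreal_mult[symmetric] ennreal_leI)
    qed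
    also have "\<dots> = ennreal A * (\<integral>\<^sup>+s. ennreal (norm (J n t s) * exp (- \<mu> * (t - s))) \<partial>lborel)"
      by (rule nn_integral_cmult) measurable
    also have "\<dots> \<le> ennreal A * ennreal ((1/2) ^ Suc n)"
      by (intro mult_left_mono \<mu>) simp
    also have "\<dots> \<le> ennreal (A * (1/2) ^ n)"
      by (simp add: A_def ennreal_mult[symmetric] ennreal_leI)
    finally show ?thesis .
  qed
  have int: "integrable lborel (J n t)" for n t
    by (rule integrableI_bounded) (use le_less_trans[OF nn[of n t]] in auto)
  show thesis
  proof (rule that[OF int])
    fix n t
    have "ennreal (\<integral>s. norm (J n t s) \<partial>lborel) \<le> ennreal (A * (1/2) ^ n)"
      using nn[of n t] nn_integral_eq_integral[OF integrable_norm[OF int[of n t]]] by simp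
    then show "(\<integral>s. norm (J n t s) \<partial>lborel) \<le> A * (1/2) ^ n"
      by (subst (asm) ennreal_le_iff) (auto simp: A_def)
  qed (simp add: A_def)
qed

lemma kernel_op_power_Suc:
  assumes "v \<in> borel_measurable borel" "\<And>s. norm (v s) \<le> B"
  shows "kernel_op G (kernel_op (J n) v) t = kernel_op (J (Suc n)) v t"
proof -
  obtain A where A: "\<And>n t. integrable lborel (J n t)"
    "\<And>n t. (\<integral>s. norm (J n t s) \<partial>lborel) \<le> A * (1/2) ^ n" "A \<ge> 0"
    by (rule power_L1_bound) blast
  have "integrable lborel (G t)" using A(1)[of 0] by simp
  then show ?thesis
    using kernel_op_comp[OF G_measurable power_measurable assms(1) _ A(1,2) assms(2)] by simp
qed

lemma kernel_op_power_bound: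
  assumes "v \<in> borel_measurable borel" "\<And>s. norm (v s) \<le> B"
  obtains C where "\<And>n t. norm (kernel_op (J n) v t) \<le> C * (1/2) ^ n" "C \<ge> 0"
proof -
  obtain A where A: "\<And>n t. integrable lborel (J n t)"
    "\<And>n t. (\<integral>s. norm (J n t s) \<partial>lborel) \<le> A * (1/2) ^ n" "A \<ge> 0"
    by (rule power_L1_bound) blast
  have "B \<ge> 0" using assms(2) norm_ge_zero order_trans by blast
  show thesis
  proof (rule that[of "A * B"])
    fix n t
    have "norm (kernel_op (J n) v t) \<le> (\<integral>s. norm (J n t s) \<partial>lborel) * B"
      by (rule norm_kernel_op_le[OF A(1) assms])
    also have "\<dots> \<le> (A * (1/2) ^ n) * B"
      by (rule mult_right_mono[OF A(2) \<open>B \<ge> 0\<close>])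
    finally show "norm (kernel_op (J n) v t) \<le> A * B * (1/2) ^ n" by (simp add: mult_ac)
  qed (use A \<open>B \<ge> 0\<close> in auto)
qed

lemma neumann_kernel_measurable:
  "case_prod (neumann_kernel G) \<in> borel_measurable (borel \<Otimes>\<^sub>M borel)"
proof -
  have "(\<lambda>z. \<Sum>n. (-1) ^ n * case_prod (J n) z) \<in> borel_measurable (borel \<Otimes>\<^sub>M borel)"
    by measurable
  then show ?thesis by (simp add: neumann_kernel_def case_prod_unfold)
qed

text \<open>
  The row integrals of the iterated kernels are summable, so by monotone convergence the series
  of kernels converges absolutely at almost every \<open>s\<close> in each row, and it may be integrated term by term.
\<close>

lemma kernel_op_neumann_sums:
  assumes vm [measurable]: "v \<in> borel_measurable borel" and B: "\<And>s. norm (v s) \<le> B"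
  shows "(\<lambda>n. (-1) ^ n * kernel_op (J n) v t) sums kernel_op (neumann_kernel G) v t"
proof -
  obtain A where A: "\<And>n t. integrable lborel (J n t)"
    "\<And>n t. (\<integral>s. norm (J n t s) \<partial>lborel) \<le> A * (1/2) ^ n" "A \<ge> 0"
    by (rule power_L1_bound) blast
  have "B \<ge> 0" using B norm_ge_zero order_trans by blast
  have "(\<integral>\<^sup>+s. (\<Sum>n. ennreal (norm (J n t s))) \<partial>lborel) = (\<Sum>n. \<integral>\<^sup>+s. norm (J n t s) \<partial>lborel)"
    by (rule nn_integral_suminf) measurable
  also have "\<dots> \<le> (\<Sum>n. ennreal (A * (1/2) ^ n))"
  proof (rule suminf_le)
    fix n
    show "(\<integral>\<^sup>+s. norm (J n t s) \<partial>lborel) \<le> ennreal (A * (1/2) ^ n)"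
      using A(2)[of n t] nn_integral_eq_integral[OF integrable_norm[OF A(1)[of n t]]]
      by (simp add: ennreal_leI)
  qed auto
  also have "\<dots> < \<infinity>"
    unfolding infinity_ennreal_def top.not_eq_extremum[symmetric]
    by (rule ennreal_suminf_neq_top[OF summable_half_powers]) (simp add: A(3))
  finally have "AE s in lborel. (\<Sum>n. ennreal (norm (J n t s))) \<noteq> \<infinity>"
    by (intro nn_integral_PInf_AE) auto
  then have abs: "AE s in lborel. summable (\<lambda>n. norm (J n t s))"
    by eventually_elim (auto intro!: summable_suminf_not_top)
  define F where "F n s = (-1) ^ n * (J n t s * v s)" for n s
  have F_int: "integrable lborel (F n)" for n
    unfolding F_def using norm_kernel_op_le(1)[of "J n" t, OF A(1) vm B] by simp
  have F_le: "norm (F n s) \<le> norm (J n t s) * B" for n s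
    using B[of s] by (simp add: F_def norm_mult norm_power mult_left_mono)
  have ae: "AE s in lborel. summable (\<lambda>n. norm (F n s))"
    using abs
  proof eventually_elim
    case (elim s)
    then have "summable (\<lambda>n. norm (J n t s) * B)" by (rule summable_mult2)
    then show ?case by (rule summable_comparison_test') (use F_le in simp)
  qed
  have sum: "summable (\<lambda>n. \<integral>s. norm (F n s) \<partial>lborel)"
  proof (rule summable_comparison_test'[OF summable_half_powers[of "A * B"]])
    fix n
    have "(\<integral>s. norm (F n s) \<partial>lborel) \<le> (\<integral>s. norm (J n t s) * B \<partial>lborel)"
      by (rule integral_mono) (use F_int A(1) F_le in auto)
    also have "\<dots> \<le> A * (1/2) ^ n * B"
      using A(2) \<open>B \<ge> 0\<close> by (simp add: mult_right_mono)
    finally show "norm (\<integral>s. norm (F n s) \<partial>lborel) \<le> A * B * (1/2) ^ n"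
      by (simp add: mult_ac)
  qed
  have "(\<lambda>n. \<integral>s. F n s \<partial>lborel) sums (\<integral>s. (\<Sum>n. F n s) \<partial>lborel)"
    by (rule sums_integral[OF F_int ae sum])
  also have "(\<lambda>n. \<integral>s. F n s \<partial>lborel) = (\<lambda>n. (-1) ^ n * kernel_op (J n) v t)"
    by (simp add: F_def kernel_op_def)
  also have "(\<integral>s. (\<Sum>n. F n s) \<partial>lborel) = kernel_op (neumann_kernel G) v t"
    unfolding kernel_op_def
  proof (rule integral_cong_AE)
    note [measurable] = kernel_section_measurable(1)[OF neumann_kernel_measurable, of t]
    show "(\<lambda>s. \<Sum>n. F n s) \<in> borel_measurable lborel"
      unfolding F_def by measurable
    show "(\<lambda>s. neumann_kernel G t s * v s) \<in> borel_measurable lborel"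
      by measurable
    show "AE s in lborel. (\<Sum>n. F n s) = neumann_kernel G t s * v s"
      using abs
    proof eventually_elim
      case (elim s)
      have "summable (\<lambda>n. norm ((-1) ^ n * J n t s))"
        using elim by (simp add: norm_mult norm_power)
      then have "summable (\<lambda>n. (-1) ^ n * J n t s)"
        by (rule summable_norm_cancel)
      then show ?case
        by (simp add: F_def neumann_kernel_def suminf_mult2 mult.assoc)
    qed
  qed
  finally show ?thesis .
qed

text \<open>
  Applying \<open>V\<^sub>G\<close> to the alternating series \<open>\<Sum>(-1)\<^sup>n V\<^sub>G\<^sup>n\<^sup>+\<^sup>1 v\<close> shifts the
  index and flips the sign, so \<open>V\<^sub>G V\<^sub>R v = V\<^sub>G v - V\<^sub>R v\<close>. The series has a summable majorant,
  which justifies the termwise application.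
\<close>

lemma neumann_kernel_solves:
  assumes vm [measurable]: "v \<in> borel_measurable borel" and B: "\<And>s. norm (v s) \<le> B"
  defines "w \<equiv> \<lambda>t. v t - kernel_op (neumann_kernel G) v t"
  shows "w t + kernel_op G w t = v t"
proof -
  obtain C where C: "\<And>n t. norm (kernel_op (J n) v t) \<le> C * (1/2) ^ n" "C \<ge> 0"
    by (rule kernel_op_power_bound[OF vm B]) blast
  define S where "S n t = (-1) ^ n * kernel_op (J n) v t" for n t
  have S_le: "norm (S n t) \<le> C * (1/2) ^ n" for n t
    using C(1)[of n t] by (simp add: S_def norm_mult norm_power)
  have S_sums: "(\<lambda>n. S n t) sums kernel_op (neumann_kernel G) v t" for t
    unfolding S_def by (rule kernel_op_neumann_sums[OF vm B])
  have [measurable]: "S n \<in> borel_measurable borel" for n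
    unfolding S_def using borel_measurable_kernel_op[OF power_measurable vm] by measurable
  obtain A where A: "\<And>n t. integrable lborel (J n t)" by (rule power_L1_bound) blast
  have Gi: "integrable lborel (G t)" using A[of 0 t] by simp
  have Gm [measurable]: "G t \<in> borel_measurable borel" using Gi by auto
  have int: "integrable lborel (\<lambda>\<xi>. G t \<xi> * S n \<xi>)" for n
    by (rule norm_kernel_op_le(1)[where B = "C * (1/2) ^ n"]) (use Gi S_le in auto)
  have le: "norm (G t \<xi> * S n \<xi>) \<le> norm (G t \<xi>) * (C * (1/2) ^ n)" for n \<xi>
    using S_le by (simp add: norm_mult mult_left_mono)
  have "(\<lambda>n. \<integral>\<xi>. G t \<xi> * S n \<xi> \<partial>lborel) sums (\<integral>\<xi>. (\<Sum>n. G t \<xi> * S n \<xi>) \<partial>lborel)"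
  proof (rule sums_integral[OF int])
    show "AE \<xi> in lborel. summable (\<lambda>n. norm (G t \<xi> * S n \<xi>))"
    proof (rule AE_I2)
      fix \<xi>
      show "summable (\<lambda>n. norm (G t \<xi> * S n \<xi>))"
        by (rule summable_comparison_test'[OF summable_mult[OF summable_half_powers[of C]]])
           (use le in auto)
    qed
    show "summable (\<lambda>n. \<integral>\<xi>. norm (G t \<xi> * S n \<xi>) \<partial>lborel)"
    proof (rule summable_comparison_test'[OF summable_mult[OF summable_half_powers[of C]]])
      fix n
      have "(\<integral>\<xi>. norm (G t \<xi> * S n \<xi>) \<partial>lborel) \<le> (\<integral>\<xi>. norm (G t \<xi>) * (C * (1/2) ^ n) \<partial>lborel)"
        by (rule integral_mono) (use int Gi le in auto)
      then show "norm (\<integral>\<xi>. norm (G t \<xi> * S n \<xi>) \<partial>lborel) \<le> (\<integral>\<xi>. norm (G t \<xi>) \<partial>lborel) * (C * (1/2) ^ n)"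
        by simp
    qed
  qed
  also have "(\<lambda>n. \<integral>\<xi>. G t \<xi> * S n \<xi> \<partial>lborel) = (\<lambda>n. - S (Suc n) t)"
  proof
    fix n
    have "(\<integral>\<xi>. G t \<xi> * S n \<xi> \<partial>lborel) = (\<integral>\<xi>. (-1) ^ n * (G t \<xi> * kernel_op (J n) v \<xi>) \<partial>lborel)"
      by (simp add: S_def mult_ac)
    also have "\<dots> = (-1) ^ n * kernel_op G (kernel_op (J n) v) t"
      by (simp add: kernel_op_def)
    also have "\<dots> = - S (Suc n) t"
      by (simp only: kernel_op_power_Suc[OF vm B]) (simp add: S_def)
    finally show "(\<integral>\<xi>. G t \<xi> * S n \<xi> \<partial>lborel) = - S (Suc n) t" .
  qed
  also have "(\<integral>\<xi>. (\<Sum>n. G t \<xi> * S n \<xi>) \<partial>lborel) = kernel_op G (kernel_op (neumann_kernel G) v) t"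
    unfolding kernel_op_def[of G] using sums_unique[OF sums_mult[OF S_sums], symmetric]
    by (intro Bochner_Integration.integral_cong) auto
  finally have "(\<lambda>n. - S (Suc n) t) sums kernel_op G (kernel_op (neumann_kernel G) v) t" .
  from sums_minus[OF this]
  have "(\<lambda>n. S (Suc n) t) sums - kernel_op G (kernel_op (neumann_kernel G) v) t" by simp
  then have "(\<lambda>n. S n t) sums (- kernel_op G (kernel_op (neumann_kernel G) v) t + S 0 t)"
    by (rule sums_Suc)
  then have eq: "kernel_op (neumann_kernel G) v t =
      kernel_op G v t - kernel_op G (kernel_op (neumann_kernel G) v) t"
    using sums_unique2[OF S_sums[of t]] by (simp add: S_def)
  have bound: "norm (kernel_op (neumann_kernel G) v \<xi>) \<le> C * 2" for \<xi>
  proof -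
    have "norm (\<Sum>n. S n \<xi>) \<le> (\<Sum>n. C * (1/2) ^ n)"
      by (rule norm_suminf_le[OF S_le summable_half_powers])
    also have "\<dots> = C * 2"
      by (subst suminf_mult) (auto simp: suminf_geometric)
    finally show ?thesis using S_sums[of \<xi>] by (simp add: sums_iff)
  qed
  have "kernel_op G w t = kernel_op G v t - kernel_op G (kernel_op (neumann_kernel G) v) t"
  proof -
    have "integrable lborel (\<lambda>s. G t s * v s)"
      by (rule norm_kernel_op_le(1)[of G t, OF Gi vm B])
    moreover have "integrable lborel (\<lambda>s. G t s * kernel_op (neumann_kernel G) v s)"
      by (rule norm_kernel_op_le(1)[of G t, OF Gi borel_measurable_kernel_op[OF neumann_kernel_measurable vm] bound])
    ultimately show ?thesis
      unfolding kernel_op_def[of G] w_def by (simp add: right_diff_distrib)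
  qed
  with eq show ?thesis by (simp add: w_def)
qed

text \<open>
  Iterating \<open>w = - V\<^sub>G w\<close> gives \<open>w = \<plusminus> V\<^sub>G\<^sup>n w\<close> for every \<open>n\<close>, and the right-hand side tends to
  \<open>0\<close>.
\<close>

lemma homogeneous_solution_zero:
  assumes wm: "w \<in> borel_measurable borel" and B: "\<And>s. norm (w s) \<le> B"
    and w: "\<And>t. w t + kernel_op G w t = 0"
  shows "w t = 0"
proof -
  obtain C where C: "\<And>n t. norm (kernel_op (J n) w t) \<le> C * (1/2) ^ n"
    by (rule kernel_op_power_bound[OF wm B]) blast
  have "kernel_op G w = (\<lambda>t. - w t)"
    using w by (metis add_eq_0_iff)
  then have *: "kernel_op G (\<lambda>t. c * w t) t = - (c * w t)" for c t
    by (simp add: kernel_op_def fun_eq_iff mult.left_commute[of _ c])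
  have iter: "kernel_op (J n) w t = (-1) ^ Suc n * w t" for n t
  proof (induction n arbitrary: t)
    case 0
    show ?case using w[of t] by (simp add: add_eq_0_iff)
  next
    case (Suc n)
    have "kernel_op (J (Suc n)) w t = kernel_op G (kernel_op (J n) w) t"
      by (rule kernel_op_power_Suc[OF wm B, symmetric])
    also have "kernel_op (J n) w = (\<lambda>t. (-1) ^ Suc n * w t)"
      using Suc.IH by blast
    finally show ?case using *[of "(-1) ^ Suc n" t] by simp
  qed
  have "norm (w t) \<le> C * (1/2) ^ n" for n
    using C[of n t] by (simp add: iter norm_mult norm_power)
  moreover have "(\<lambda>n. C * (1/2) ^ n) \<longlonglongrightarrow> 0"
    using summable_LIMSEQ_zero[OF summable_half_powers] .
  ultimately have "norm (w t) \<le> 0"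
    by (intro LIMSEQ_le_const) auto
  then show ?thesis by simp
qed

text \<open>
  A single kernel operator preserves continuity by assumption, hence so do its powers, and the Neumann
  series converges uniformly on \<open>[0,T]\<close>.
\<close>

lemma continuous_on_kernel_op_neumann:
  assumes vm: "v \<in> borel_measurable borel" and B: "\<And>s. norm (v s) \<le> B"
    and vc: "continuous_on {0..T} v"
    and cont: "\<And>v B. \<lbrakk>v \<in> borel_measurable borel; \<And>s. norm (v s) \<le> B; continuous_on {0..T} v\<rbrakk>
                 \<Longrightarrow> continuous_on {0..T} (kernel_op G v)"
  shows "continuous_on {0..T} (kernel_op (neumann_kernel G) v)"
proof -
  obtain C where C: "\<And>n t. norm (kernel_op (J n) v t) \<le> C * (1/2) ^ n" "C \<ge> 0"
    by (rule kernel_op_power_bound[OF vm B]) blast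
  have power: "continuous_on {0..T} (kernel_op (J n) v)" for n
  proof (induction n)
    case 0
    show ?case using cont[OF vm B vc] by simp
  next
    case (Suc n)
    have "continuous_on {0..T} (kernel_op G (kernel_op (J n) v))"
      by (rule cont[OF borel_measurable_kernel_op[OF power_measurable vm] C(1) Suc.IH])
    moreover have "kernel_op G (kernel_op (J n) v) = kernel_op (J (Suc n)) v"
      using kernel_op_power_Suc[OF vm B] by blast
    ultimately show ?case by simp
  qed
  have "uniform_limit {0..T} (\<lambda>n t. \<Sum>i<n. (-1) ^ i * kernel_op (J i) v t)
      (\<lambda>t. \<Sum>i. (-1) ^ i * kernel_op (J i) v t) sequentially"
    by (rule Weierstrass_m_test[OF _ summable_half_powers[of C]])
       (use C(1) in \<open>auto simp: norm_mult norm_power\<close>)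
  then have "continuous_on {0..T} (\<lambda>t. \<Sum>i. (-1) ^ i * kernel_op (J i) v t)"
    by (rule uniform_limit_theorem[rotated])
       (auto intro!: always_eventually continuous_intros power)
  also have "(\<lambda>t. \<Sum>i. (-1) ^ i * kernel_op (J i) v t) = kernel_op (neumann_kernel G) v"
    using kernel_op_neumann_sums[OF vm B] by (auto simp: sums_iff)
  finally show ?thesis .
qed

end

context volterra_kernel
begin

lemma neumann_kernel_supp: "\<not> (0 \<le> s \<and> s < t \<and> t \<le> T) \<Longrightarrow> neumann_kernel G t s = 0"
  by (simp add: neumann_kernel_def power_supp)

text \<open>
  Equality in almost every point of each row and of each column is what composition of kernels
  respects: the integrand \<open>\<Gamma>(t,\<xi>) \<Gamma>\<^sub>n(\<xi>,s)\<close> involves a row of \<open>\<Gamma>\<close> and a column of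
  \<open>\<Gamma>\<^sub>n\<close>. Both statements must be carried through the induction, and from the second kernel on the
  agreement is pointwise.
\<close>

lemma iterated_kernel_eq_power:
  assumes row: "\<And>t. t \<in> {0..T} \<Longrightarrow> AE s in lborel. s \<in> {0..t} \<longrightarrow> \<Gamma> t s = G t s"
    and col: "\<And>s. s \<in> {0..T} \<Longrightarrow> AE t in lborel. t \<in> {s..T} \<longrightarrow> \<Gamma> t s = G t s"
  shows "t \<in> {0..T} \<Longrightarrow> AE s in lborel. s \<in> {0..t} \<longrightarrow> iterated_kernel \<Gamma> n t s = J n t s"
    and "s \<in> {0..T} \<Longrightarrow> AE t in lborel. t \<in> {s..T} \<longrightarrow> iterated_kernel \<Gamma> n t s = J n t s"
proof (induction n arbitrary: s t)
  case 0
  {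
    case 1
    then show ?case using row by simp
  next
    case 2
    then show ?case using col by simp
  }
next
  case (Suc n)
  have eq: "iterated_kernel \<Gamma> (Suc n) t s = J (Suc n) t s" if "0 \<le> s" "s \<le> t" "t \<le> T" for t s
  proof -
    have [measurable]: "G t \<in> borel_measurable borel" using section_measurable(1)[of 0 t] by simp
    have "(LINT \<xi>:{s..t}|lebesgue. \<Gamma> t \<xi> * iterated_kernel \<Gamma> n \<xi> s) = (\<integral>\<xi>. G t \<xi> * J n \<xi> s \<partial>lborel)"
    proof (rule set_lebesgue_integral_eq_lborel)
      show "AE \<xi> in lborel. \<xi> \<in> {s..t} \<longrightarrow> \<Gamma> t \<xi> * iterated_kernel \<Gamma> n \<xi> s = G t \<xi> * J n \<xi> s"
        using row[of t] Suc.IH(2)[of s] that by (auto elim: eventually_elim2)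
      show "G t \<xi> * J n \<xi> s = 0" if "\<xi> \<notin> {s..t}" for \<xi>
        using that G_supp[of \<xi> t] power_supp[of s \<xi> n] by (cases "\<xi> < s") auto
    qed measurable
    then show ?thesis by simp
  qed
  {
    case 1
    then show ?case by (intro AE_I2) (auto simp del: iterated_kernel.simps kernel_power.simps intro!: eq)
  next
    case 2
    then show ?case by (intro AE_I2) (auto simp del: iterated_kernel.simps kernel_power.simps intro!: eq)
  }
qed

lemma volterra_op_resolvent_eq:
  fixes f :: "real \<Rightarrow> complex"
  assumes row: "\<And>t. t \<in> {0..T} \<Longrightarrow> AE s in lborel. s \<in> {0..t} \<longrightarrow> \<Gamma> t s = G t s"
    and col: "\<And>s. s \<in> {0..T} \<Longrightarrow> AE t in lborel. t \<in> {s..T} \<longrightarrow> \<Gamma> t s = G t s"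
    and f: "continuous_on {0..T} f" and t: "t \<in> {0..T}"
  shows "volterra_op T (resolvent_kernel \<Gamma>) f t =
    kernel_op (neumann_kernel G) (\<lambda>s. indicator {0..T} s *\<^sub>R f s) t"
proof -
  have [measurable]: "neumann_kernel G t \<in> borel_measurable borel"
    by (rule kernel_section_measurable[OF neumann_kernel_measurable])
  have fm: "(\<lambda>s. indicator {0..T} s *\<^sub>R f s) \<in> borel_measurable borel"
    by (rule borel_measurable_continuous_on_indicator[OF _ f]) simp
  have "AE s in lborel. \<forall>n. s \<in> {0..t} \<longrightarrow> iterated_kernel \<Gamma> n t s = J n t s"
    unfolding AE_all_countable using iterated_kernel_eq_power(1)[OF row col t] by blast
  then have "AE s in lborel. s \<in> {0..t} \<longrightarrow> resolvent_kernel \<Gamma> t s = neumann_kernel G t s"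
    by eventually_elim (simp add: resolvent_kernel_def neumann_kernel_def)
  then have "AE s in lborel. s \<in> {0..t} \<longrightarrow> resolvent_kernel \<Gamma> t s * f s =
      neumann_kernel G t s * (indicator {0..T} s *\<^sub>R f s)"
    by eventually_elim (use t in auto)
  moreover have "(\<lambda>s. neumann_kernel G t s * (indicator {0..T} s *\<^sub>R f s)) \<in> borel_measurable borel"
    by (intro borel_measurable_times fm) measurable
  moreover have "neumann_kernel G t s * (indicator {0..T} s *\<^sub>R f s) = 0" if "s \<notin> {0..t}" for s
    using neumann_kernel_supp[of s t] that by auto
  ultimately have "(LINT s:{0..t}|lebesgue. resolvent_kernel \<Gamma> t s * f s) =
      (\<integral>s. neumann_kernel G t s * (indicator {0..T} s *\<^sub>R f s) \<partial>lborel)"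
    by (intro set_lebesgue_integral_eq_lborel)
  then show ?thesis
    using t by (simp add: volterra_op_def kernel_op_def)
qed

end

section \<open>Convolution kernels\<close>

abbreviation (input) volterra_triangle :: "real \<Rightarrow> (real \<times> real) set" where
  "volterra_triangle T \<equiv> {(t, s). 0 \<le> s \<and> s \<le> t \<and> t \<le> T}"

lemma compact_triangle: "compact (volterra_triangle T)"
proof -
  have "volterra_triangle T = {z. 0 \<le> snd z} \<inter> {z. snd z \<le> fst z} \<inter> {z. fst z \<le> T}" by auto
  moreover have "closed \<dots>"
    by (intro closed_Int closed_Collect_le continuous_intros)
  moreover have "volterra_triangle T \<subseteq> {0..T} \<times> {0..T}" by auto
  moreover have "bounded ({0..T} \<times> {0..T})"
    by (intro bounded_Times bounded_closed_interval)
  ultimately show ?thesis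
    using bounded_subset by (simp only: compact_eq_bounded_closed) blast
qed

lemma continuous_extension_by_zero:
  fixes v :: "real \<Rightarrow> complex"
  assumes "continuous_on {0..T} v"
  obtains B where "(\<lambda>t. indicator {0..T} t *\<^sub>R v t) \<in> borel_measurable borel"
    "\<And>t. norm (indicator {0..T} t *\<^sub>R v t) \<le> B"
proof -
  have "bounded (v ` {0..T})"
    using assms by (intro compact_imp_bounded compact_continuous_image) auto
  then obtain B where "\<forall>t\<in>{0..T}. norm (v t) \<le> B"
    by (auto simp: bounded_iff)
  then have "norm (indicator {0..T} t *\<^sub>R v t) \<le> max B 0" for t
    by (cases "t \<in> {0..T}") (auto simp: le_max_iff_disj)
  then show thesis
    by (intro that[of "max B 0"] borel_measurable_continuous_on_indicator assms) auto
qed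

lemma continuous_on_extension_by_zero:
  fixes v :: "real \<Rightarrow> complex"
  assumes "continuous_on S v"
  shows "continuous_on S (\<lambda>t. indicator S t *\<^sub>R v t)"
  by (rule continuous_on_eq[OF assms]) simp

text \<open>
  As \<open>t\<close> tends to \<open>a\<close>, the integrand converges at every \<open>x\<close> except possibly at the moving endpoint
  \<open>x = a\<close>, and it is dominated by a multiple of \<open>|r|\<close>. After a change of variables this covers
  convolutions \<open>\<integral> v(t - x) r(x) dx\<close>, where the weak singularity sits in \<open>r\<close>, and for bounded \<open>r\<close>
  also the memory term.
\<close>

lemma continuous_on_volterra_integral:
  fixes F :: "real \<Rightarrow> real \<Rightarrow> complex"
  assumes F: "continuous_on (volterra_triangle T) (\<lambda>(t, x). F t x)" and r: "integrable lborel r"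
  shows "continuous_on {0..T} (\<lambda>t. \<integral>x. indicator {0..t} x *\<^sub>R F t x * r x \<partial>lborel)"
proof (rule continuous_on_sequentiallyI)
  fix u :: "nat \<Rightarrow> real" and a assume u: "\<forall>n. u n \<in> {0..T}" and a: "a \<in> {0..T}" and lim: "u \<longlonglongrightarrow> a"
  have "bounded ((\<lambda>(t, x). F t x) ` volterra_triangle T)"
    by (intro compact_imp_bounded compact_continuous_image F compact_triangle)
  then obtain M0 where M0: "\<And>t x. (t, x) \<in> volterra_triangle T \<Longrightarrow> norm (F t x) \<le> M0"
    by (force simp: bounded_iff)
  define M where "M = max M0 0"
  have M: "norm (indicator {0..t} x *\<^sub>R F t x) \<le> M" if "t \<in> {0..T}" for t x
    using M0[of t x] that by (auto simp: M_def indicator_def le_max_iff_disj)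
  have [measurable]: "r \<in> borel_measurable borel" using r by auto
  have Fm: "(\<lambda>x. indicator {0..t} x *\<^sub>R F t x) \<in> borel_measurable borel" if "t \<in> {0..T}" for t
  proof (rule borel_measurable_continuous_on_indicator)
    have "continuous_on {0..t} ((\<lambda>(t, x). F t x) \<circ> (\<lambda>x. (t, x)))"
      by (intro continuous_on_compose continuous_intros continuous_on_subset[OF F]) (use that in auto)
    then show "continuous_on {0..t} (F t)" by (simp add: comp_def)
  qed simp
  show "(\<lambda>n. \<integral>x. indicator {0..u n} x *\<^sub>R F (u n) x * r x \<partial>lborel)
      \<longlonglongrightarrow> (\<integral>x. indicator {0..a} x *\<^sub>R F a x * r x \<partial>lborel)"
  proof (rule integral_dominated_convergence[where w = "\<lambda>x. M * norm (r x)"])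
    show "(\<lambda>x. indicator {0..a} x *\<^sub>R F a x * r x) \<in> borel_measurable lborel"
      using Fm[OF a] by measurable
    show "(\<lambda>x. indicator {0..u n} x *\<^sub>R F (u n) x * r x) \<in> borel_measurable lborel" for n
      using Fm[OF u[rule_format], of n] by measurable
    show "integrable lborel (\<lambda>x. M * norm (r x))" using r by simp
    show "AE x in lborel. norm (indicator {0..u n} x *\<^sub>R F (u n) x * r x) \<le> M * norm (r x)" for n
      unfolding norm_mult[of _ "r _"] by (intro AE_I2 mult_right_mono M) (use u in auto)
    show "AE x in lborel. (\<lambda>n. indicator {0..u n} x *\<^sub>R F (u n) x * r x)
        \<longlonglongrightarrow> indicator {0..a} x *\<^sub>R F a x * r x"
      using AE_lborel_singleton[of a]
    proof eventually_elim
      case (elim x)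
      show ?case
      proof (cases "0 \<le> x \<and> x < a")
        case True
        have ev: "eventually (\<lambda>n. x < u n) sequentially"
          using order_tendstoD(1)[OF lim] True by auto
        have "(\<lambda>n. (u n, x)) \<longlonglongrightarrow> (a, x)"
          by (intro tendsto_intros lim)
        moreover have "eventually (\<lambda>n. (u n, x) \<in> volterra_triangle T) sequentially"
          using ev u True by (auto elim!: eventually_mono)
        moreover have "(a, x) \<in> volterra_triangle T" using a True by auto
        ultimately have "(\<lambda>n. F (u n) x) \<longlonglongrightarrow> F a x"
          using continuous_on_tendsto_compose[OF F, of "\<lambda>n. (u n, x)" "(a, x)" sequentially] by simp
        then have "(\<lambda>n. F (u n) x * r x) \<longlonglongrightarrow> F a x * r x"
          by (intro tendsto_intros)
        moreover have "eventually (\<lambda>n. F (u n) x * r x = indicator {0..u n} x *\<^sub>R F (u n) x * r x) sequentially"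
          using ev True by (auto elim!: eventually_mono)
        ultimately have "(\<lambda>n. indicator {0..u n} x *\<^sub>R F (u n) x * r x) \<longlonglongrightarrow> F a x * r x"
          by (rule Lim_transform_eventually)
        then show ?thesis using True by simp
      next
        case False
        have "eventually (\<lambda>n. 0 = indicator {0..u n} x *\<^sub>R F (u n) x * r x) sequentially"
        proof (cases "x < 0")
          case False
          with \<open>\<not> (0 \<le> x \<and> x < a)\<close> elim have "a < x" by auto
          then have "eventually (\<lambda>n. u n < x) sequentially"
            using order_tendstoD(2)[OF lim] by auto
          then show ?thesis by (auto elim!: eventually_mono)
        qed auto
        then have "(\<lambda>n. indicator {0..u n} x *\<^sub>R F (u n) x * r x) \<longlonglongrightarrow> 0"
          by (rule Lim_transform_eventually[OF tendsto_const])
        then show ?thesis using False elim by (auto simp: indicator_def)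
      qed
    qed
  qed
qed

definition conv_kernel :: "(real \<Rightarrow> complex) \<Rightarrow> real \<Rightarrow> real \<Rightarrow> complex" where
  "conv_kernel r t s = r (t - s)"

lemma conv_kernel_measurable:
  assumes [measurable]: "r \<in> borel_measurable borel"
  shows "case_prod (conv_kernel r) \<in> borel_measurable (borel \<Otimes>\<^sub>M borel)"
  unfolding conv_kernel_def by measurable

lemma conv_kernel_integrable:
  assumes "integrable lborel r"
  shows "integrable lborel (conv_kernel r t)"
    and "(\<integral>s. norm (conv_kernel r t s) \<partial>lborel) = (\<integral>s. norm (r s) \<partial>lborel)"
  using lborel_integrable_real_affine[OF assms, of "-1" t]
    lborel_integral_real_affine[of "-1" "\<lambda>s. norm (r s)" t]
  by (simp_all add: conv_kernel_def[abs_def])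

lemma kernel_op_conv_kernel_commute:
  "kernel_op (conv_kernel a) b t = kernel_op (conv_kernel b) a t"
  using lborel_integral_real_affine[of "-1" "\<lambda>s. a (t - s) * b s" t]
  by (simp add: kernel_op_def conv_kernel_def mult.commute)

lemma kernel_op_conv_kernel_assoc:
  assumes a: "integrable lborel a" and b: "integrable lborel b"
    and v: "v \<in> borel_measurable borel" "\<And>s. norm (v s) \<le> B"
  shows "kernel_op (conv_kernel a) (kernel_op (conv_kernel b) v) t =
    kernel_op (conv_kernel (kernel_op (conv_kernel a) b)) v t"
proof -
  have [measurable]: "a \<in> borel_measurable borel" "b \<in> borel_measurable borel"
    using a b by auto
  have "(\<integral>\<xi>. conv_kernel a t \<xi> * conv_kernel b \<xi> s \<partial>lborel) = kernel_op (conv_kernel a) b (t - s)" for t s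
    using lborel_integral_real_affine[of 1 "\<lambda>\<xi>. a (t - \<xi>) * b (\<xi> - s)" s]
    by (simp add: kernel_op_def conv_kernel_def diff_diff_eq)
  then have "(\<lambda>t s. \<integral>\<xi>. conv_kernel a t \<xi> * conv_kernel b \<xi> s \<partial>lborel) =
      conv_kernel (kernel_op (conv_kernel a) b)"
    by (simp add: fun_eq_iff conv_kernel_def[of "kernel_op (conv_kernel a) b"])
  moreover have "kernel_op (conv_kernel a) (kernel_op (conv_kernel b) v) t =
      kernel_op (\<lambda>t s. \<integral>\<xi>. conv_kernel a t \<xi> * conv_kernel b \<xi> s \<partial>lborel) v t"
    by (rule kernel_op_comp[where b = "\<integral>s. norm (b s) \<partial>lborel", OF _ _ v(1) _ _ _ v(2)])
       (simp_all add: conv_kernel_measurable conv_kernel_integrable a b)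
  ultimately show ?thesis by simp
qed

lemma kernel_op_conv_kernel_neg:
  assumes "\<And>x. x \<le> 0 \<Longrightarrow> r x = 0" "\<And>s. s < 0 \<Longrightarrow> v s = 0" "t \<le> 0"
  shows "kernel_op (conv_kernel r) v t = 0"
proof -
  have "r (t - s) * v s = 0" for s
    using assms by (cases "s < 0") auto
  then have "(\<lambda>s. r (t - s) * v s) = (\<lambda>_. 0)" by (rule ext)
  then show ?thesis by (simp only: kernel_op_def conv_kernel_def) simp
qed

lemma continuous_on_kernel_op_conv_kernel:
  assumes r: "integrable lborel r" and r0: "\<And>x. x \<le> 0 \<Longrightarrow> r x = 0"
    and v: "continuous_on {0..T} v" and v0: "\<And>s. s < 0 \<Longrightarrow> v s = 0"
  shows "continuous_on {0..T} (kernel_op (conv_kernel r) v)"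
proof -
  have "continuous_on (volterra_triangle T) (v \<circ> (\<lambda>(t, x). t - x))"
    by (intro continuous_on_compose continuous_on_subset[OF v])
       (auto intro!: continuous_intros simp: case_prod_unfold)
  then have "continuous_on {0..T} (\<lambda>t. \<integral>x. indicator {0..t} x *\<^sub>R v (t - x) * r x \<partial>lborel)"
    by (intro continuous_on_volterra_integral r) (simp add: comp_def case_prod_unfold)
  also have "(\<lambda>t. \<integral>x. indicator {0..t} x *\<^sub>R v (t - x) * r x \<partial>lborel) = kernel_op (conv_kernel r) v"
  proof
    fix t
    have "(\<lambda>x. indicator {0..t} x *\<^sub>R v (t - x) * r x) = (\<lambda>x. v (t - x) * r x)"
      using r0 v0 by (auto simp: indicator_def fun_eq_iff) 
    then show "(\<integral>x. indicator {0..t} x *\<^sub>R v (t - x) * r x \<partial>lborel) = kernel_op (conv_kernel r) v t"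
      by (subst kernel_op_conv_kernel_commute) (simp add: kernel_op_def conv_kernel_def)
  qed
  finally show ?thesis .
qed

text \<open>
  If \<open>c\<close> agrees with the Heaviside function up to \<open>T\<close>, then convolution with \<open>c\<close> is integration from
  \<open>0\<close>, which is differentiable.
\<close>

lemma kernel_op_heaviside:
  fixes w :: "real \<Rightarrow> complex"
  assumes c1: "\<And>x. 0 < x \<Longrightarrow> x \<le> T \<Longrightarrow> c x = 1" and c0: "\<And>x. x \<le> 0 \<Longrightarrow> c x = 0"
    and w: "continuous_on {0..T} w" and w0: "\<And>s. s < 0 \<Longrightarrow> w s = 0" and t: "t \<in> {0..T}"
  shows "kernel_op (conv_kernel c) w t = integral {0..t} w"
proof -
  have wt: "continuous_on {0..t} w" by (rule continuous_on_subset[OF w]) (use t in auto)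
  have 1: "set_integrable lborel {0..t} w"
    by (rule borel_integrable_atLeastAtMost') (rule wt)
  have m: "(\<lambda>s. indicator {0..t} s *\<^sub>R w s) \<in> borel_measurable borel"
    by (rule borel_measurable_continuous_on_indicator[OF _ wt]) simp
  have "kernel_op (conv_kernel c) w t = (\<integral>s. indicator {0..<t} s *\<^sub>R w s \<partial>lborel)"
    unfolding kernel_op_def
  proof (rule Bochner_Integration.integral_cong)
    fix s
    show "conv_kernel c t s * w s = indicator {0..<t} s *\<^sub>R w s"
      using c1[of "t - s"] c0[of "t - s"] w0[of s] t by (auto simp: conv_kernel_def indicator_def)
  qed simp
  also have "\<dots> = (\<integral>s. indicator {0..t} s *\<^sub>R w s \<partial>lborel)"
  proof (rule integral_cong_AE)
    have "(\<lambda>s. indicator {0..<t} s *\<^sub>R (indicator {0..t} s *\<^sub>R w s)) \<in> borel_measurable borel"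
      using m by measurable
    moreover have "(\<lambda>s. indicator {0..<t} s *\<^sub>R (indicator {0..t} s *\<^sub>R w s)) = (\<lambda>s. indicator {0..<t} s *\<^sub>R w s)"
      by (auto simp: indicator_def)
    ultimately show "(\<lambda>s. indicator {0..<t} s *\<^sub>R w s) \<in> borel_measurable lborel" by simp
    show "AE s in lborel. indicator {0..<t} s *\<^sub>R w s = indicator {0..t} s *\<^sub>R w s"
      using AE_lborel_singleton[of t] by eventually_elim (auto simp: indicator_def)
  qed (use m in simp)
  also have "\<dots> = integral {0..t} w"
    using set_borel_integral_eq_integral(2)[OF 1] by (simp add: set_lebesgue_integral_def)
  finally show ?thesis .
qed

text \<open>
  The open interval is used because the values of an integrable kernel at \<open>0\<close> and \<open>T\<close> are
  immaterial; with this choice the vanishing of \<open>r'\<close> on \<open>(-\<infinity>,0]\<close> restricts the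
  convolution to \<open>s < t\<close>.
\<close>

definition represents :: "real \<Rightarrow> (real \<Rightarrow> complex) \<Rightarrow> (real \<Rightarrow> complex) \<Rightarrow> bool" where
  "represents T r' r \<longleftrightarrow> integrable lborel r' \<and> (\<forall>x. x \<notin> {0<..<T} \<longrightarrow> r' x = 0) \<and>
     (AE x in lborel. x \<in> {0<..<T} \<longrightarrow> r' x = r x)"

lemma representsD:
  assumes "represents T r' r"
  shows "integrable lborel r'" "r' \<in> borel_measurable borel"
    "\<And>x. x \<notin> {0<..<T} \<Longrightarrow> r' x = 0" "\<And>x. x \<le> 0 \<Longrightarrow> r' x = 0"
    "AE x in lborel. x \<in> {0<..<T} \<longrightarrow> r' x = r x"
  using assms by (auto simp: represents_def)

lemma represents_exists:
  assumes "set_integrable lebesgue {0<..<T} r"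
  shows "\<exists>r'. represents T r' r"
  using borel_representative[OF assms] unfolding represents_def by metis

lemma conv_eq_kernel_op:
  assumes r: "represents T r' r" and t: "t \<in> {0..T}"
    and [measurable]: "w' \<in> borel_measurable borel" and w: "AE s in lborel. s \<in> {0<..<T} \<longrightarrow> w' s = w s"
    and w0: "\<And>s. s < 0 \<Longrightarrow> w' s = 0"
  shows "conv r w t = kernel_op (conv_kernel r') w' t"
  unfolding conv_def kernel_op_def
proof (rule set_lebesgue_integral_eq_lborel)
  note [measurable] = representsD(2)[OF r]
  show "(\<lambda>s. conv_kernel r' t s * w' s) \<in> borel_measurable borel"
    unfolding conv_kernel_def by measurable
  show "conv_kernel r' t s * w' s = 0" if "s \<notin> {0..t}" for s
    using that w0[of s] representsD(4)[OF r, of "t - s"] by (auto simp: conv_kernel_def)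
  show "AE s in lborel. s \<in> {0..t} \<longrightarrow> r (t - s) * w s = conv_kernel r' t s * w' s"
    using AE_lborel_reflect[OF representsD(5)[OF r], of t] w AE_lborel_singleton[of t] AE_lborel_singleton[of 0]
    by eventually_elim (use t in \<open>auto simp: conv_kernel_def\<close>)
qed

lemma conv_op_eq_kernel_op:
  assumes \<kappa>: "represents T \<kappa>' \<kappa>" and v: "continuous_on {0..T} v" and t: "t \<in> {0..T}"
  shows "conv_op T \<kappa> v t = kernel_op (conv_kernel \<kappa>') (\<lambda>s. indicator {0..T} s *\<^sub>R v s) t"
proof -
  have "(\<lambda>s. indicator {0..T} s *\<^sub>R v s) \<in> borel_measurable borel"
    by (rule borel_measurable_continuous_on_indicator[OF _ v]) simp
  from conv_eq_kernel_op[OF \<kappa> t this, of v] t show ?thesis by (simp add: conv_op_def)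
qed

text \<open>
  The scheme behind both derivatives. By associativity \<open>V\<^sub>r I\<^sub>\<kappa> v\<close> is convolution of \<open>v\<close> with
  \<open>r * \<kappa>\<close>, and only the values \<open>c\<close> of \<open>r * \<kappa>\<close> on \<open>(0,T)\<close>, up to a null set, enter on
  \<open>[0,T]\<close>. If the result is the primitive of a continuous \<open>w\<close>, then \<open>w\<close> is the derivative, one-sided
  at the endpoints.
\<close>

lemma D_op_conv_op:
  fixes v :: "real \<Rightarrow> complex"
  assumes "T > 0" and r: "represents T r' r" and \<kappa>: "represents T \<kappa>' \<kappa>" and v: "continuous_on {0..T} v"
    and c: "AE x in lborel. x \<in> {0<..<T} \<longrightarrow> kernel_op (conv_kernel r') \<kappa>' x = c x"
    and c0: "\<And>x. x \<le> 0 \<Longrightarrow> c x = 0" and [measurable]: "c \<in> borel_measurable borel"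
    and w: "\<And>t. t \<in> {0..T} \<Longrightarrow>
      kernel_op (conv_kernel c) (\<lambda>s. indicator {0..T} s *\<^sub>R v s) t = integral {0..t} w"
    and wc: "continuous_on {0..T} w" and t: "t \<in> {0..T}"
  shows "D_op T r (conv_op T \<kappa> v) t = w t"
proof -
  define v' where "v' s = indicator {0..T} s *\<^sub>R v s" for s
  obtain B where v'm [measurable]: "v' \<in> borel_measurable borel" and B: "\<And>s. norm (v' s) \<le> B"
    using continuous_extension_by_zero[OF v] unfolding v'_def[abs_def] by blast
  note [measurable] = representsD(2)[OF r] representsD(2)[OF \<kappa>]
  have u'm: "kernel_op (conv_kernel \<kappa>') v' \<in> borel_measurable borel"
    by (intro borel_measurable_kernel_op conv_kernel_measurable) measurable
  have cm: "kernel_op (conv_kernel r') \<kappa>' \<in> borel_measurable borel"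
    by (intro borel_measurable_kernel_op conv_kernel_measurable) measurable
  note [measurable] = kernel_section_measurable(1)[OF conv_kernel_measurable[OF cm]]
    kernel_section_measurable(1)[OF conv_kernel_measurable[of c]]
  have prim: "conv_op T r (conv_op T \<kappa> v) t = integral {0..t} w" if t: "t \<in> {0..T}" for t
  proof -
    have "conv_op T r (conv_op T \<kappa> v) t = conv r (conv_op T \<kappa> v) t"
      using t by (simp add: conv_op_def)
    also have "\<dots> = kernel_op (conv_kernel r') (kernel_op (conv_kernel \<kappa>') v') t"
    proof (rule conv_eq_kernel_op[OF r t u'm])
      show "AE s in lborel. s \<in> {0<..<T} \<longrightarrow> kernel_op (conv_kernel \<kappa>') v' s = conv_op T \<kappa> v s"
        using conv_op_eq_kernel_op[OF \<kappa> v] by (intro AE_I2) (auto simp: v'_def[abs_def])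
      show "kernel_op (conv_kernel \<kappa>') v' s = 0" if "s < 0" for s
        using that by (intro kernel_op_conv_kernel_neg representsD(4)[OF \<kappa>]) (auto simp: v'_def)
    qed
    also have "\<dots> = kernel_op (conv_kernel (kernel_op (conv_kernel r') \<kappa>')) v' t"
      by (rule kernel_op_conv_kernel_assoc[OF representsD(1)[OF r] representsD(1)[OF \<kappa>] v'm B])
    also have "\<dots> = kernel_op (conv_kernel c) v' t"
      unfolding kernel_op_def[of _ v']
    proof (rule integral_cong_AE)
      show "AE s in lborel. conv_kernel (kernel_op (conv_kernel r') \<kappa>') t s * v' s = conv_kernel c t s * v' s"
        using AE_lborel_reflect[OF c, of t] AE_lborel_singleton[of 0]
      proof eventually_elim
        case (elim s)
        show ?case
        proof (cases "0 < s \<and> s < t")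
          case True
          then show ?thesis using elim t by (auto simp: conv_kernel_def)
        next
          case False
          then have "t - s \<le> 0 \<or> v' s = 0" using elim by (auto simp: v'_def)
          then show ?thesis
            using c0[of "t - s"] kernel_op_conv_kernel_neg[where v = \<kappa>' and t = "t - s", OF representsD(4)[OF r]]
              representsD(4)[OF \<kappa>] by (auto simp: conv_kernel_def)
        qed
      qed
    qed measurable
    also have "\<dots> = integral {0..t} w"
      using w[OF t] by (simp add: v'_def[abs_def])
    finally show ?thesis .
  qed
  have "((\<lambda>t. integral {0..t} w) has_vector_derivative w t) (at t within {0..T})"
    by (rule integral_has_vector_derivative[OF wc t])
  then have "(conv_op T r (conv_op T \<kappa> v) has_vector_derivative w t) (at t within {0..T})"
    by (rule has_vector_derivative_transform[OF t, rotated]) (simp add: prim)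
  then show ?thesis
    unfolding D_op_def by (rule vector_derivative_within_closed_interval[OF \<open>T > 0\<close> t])
qed

text \<open>
  For a Sonine pair \<open>k * \<kappa>\<close> is the Heaviside function on \<open>(0,T]\<close>, so \<open>D\<^sub>k\<close> inverts
  \<open>I\<^sub>\<kappa>\<close>.
\<close>

lemma D_op_sonine:
  assumes "T > 0" and k: "represents T k' k" and \<kappa>: "represents T \<kappa>' \<kappa>"
    and sonine: "\<And>t. t \<in> {0<..T} \<Longrightarrow> conv \<kappa> k t = 1"
    and v: "continuous_on {0..T} v" and t: "t \<in> {0..T}"
  shows "D_op T k (conv_op T \<kappa> v) t = v t"
proof (rule D_op_conv_op[OF \<open>T > 0\<close> k \<kappa> v _ _ _ _ v t])
  let ?c = "indicator {0<..T} :: real \<Rightarrow> complex"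
  show "AE x in lborel. x \<in> {0<..<T} \<longrightarrow> kernel_op (conv_kernel k') \<kappa>' x = ?c x"
  proof (intro AE_I2 impI)
    fix x assume x: "x \<in> {0<..<T}"
    have "conv \<kappa> k x = kernel_op (conv_kernel \<kappa>') k' x"
      by (rule conv_eq_kernel_op[OF \<kappa>]) (use x representsD[OF k] in auto)
    then show "kernel_op (conv_kernel k') \<kappa>' x = ?c x"
      using sonine[of x] x kernel_op_conv_kernel_commute[of k' \<kappa>' x] by simp
  qed
  fix t assume t: "t \<in> {0..T}"
  have "kernel_op (conv_kernel ?c) (\<lambda>s. indicator {0..T} s *\<^sub>R v s) t =
      integral {0..t} (\<lambda>s. indicator {0..T} s *\<^sub>R v s)"
    by (rule kernel_op_heaviside[where T = T])
       (use t continuous_on_extension_by_zero[OF v] in auto)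
  also have "\<dots> = integral {0..t} v"
    by (rule integral_cong) (use t in auto)
  finally show "kernel_op (conv_kernel ?c) (\<lambda>s. indicator {0..T} s *\<^sub>R v s) t = integral {0..t} v" .
qed auto

text \<open>
  Here \<open>r * \<kappa> = g\<close> is the primitive of \<open>q\<close>, that is, the convolution \<open>H * q\<close> with the Heaviside
  function \<open>H\<close>. Associativity turns \<open>(H * q) * v\<close> into the primitive of the continuous function
  \<open>q * v\<close>.
\<close>

lemma D_op_primitive:
  fixes v :: "real \<Rightarrow> complex"
  assumes "T > 0" and r: "represents T r' r" and \<kappa>: "represents T \<kappa>' \<kappa>" and q: "represents T q' q"
    and g: "AE x in lborel. x \<in> {0<..<T} \<longrightarrow> g x = conv r \<kappa> x"
    and gq: "\<And>x. x \<in> {0..T} \<Longrightarrow> (q has_integral g x) {0..x}"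
    and v: "continuous_on {0..T} v" and t: "t \<in> {0..T}"
  shows "D_op T r (conv_op T \<kappa> v) t = kernel_op (conv_kernel q') (\<lambda>s. indicator {0..T} s *\<^sub>R v s) t"
proof -
  let ?H = "indicator {0<..T} :: real \<Rightarrow> complex"
  define v' where "v' s = indicator {0..T} s *\<^sub>R v s" for s
  obtain B where v'm [measurable]: "v' \<in> borel_measurable borel" and B: "\<And>s. norm (v' s) \<le> B"
    using continuous_extension_by_zero[OF v] unfolding v'_def[abs_def] by blast
  have v'c: "continuous_on {0..T} v'"
    using continuous_on_extension_by_zero[OF v] by (simp add: v'_def[abs_def])
  note [measurable] = representsD(2)[OF q]
  have H: "integrable lborel ?H"
    by (rule integrable_real_indicator[THEN integrable_of_real, where 'a = complex, of "{0<..T}" lborel, simplified of_real_indicator]) (use \<open>T > 0\<close> in auto)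
  have cm: "kernel_op (conv_kernel ?H) q' \<in> borel_measurable borel"
    by (intro borel_measurable_kernel_op conv_kernel_measurable) measurable
  have wc: "continuous_on {0..T} (kernel_op (conv_kernel q') v')"
    by (rule continuous_on_kernel_op_conv_kernel[OF representsD(1)[OF q] representsD(4)[OF q] v'c])
       (auto simp: v'_def)
  have "D_op T r (conv_op T \<kappa> v) t = kernel_op (conv_kernel q') v' t"
  proof (rule D_op_conv_op[OF \<open>T > 0\<close> r \<kappa> v _ _ cm _ wc t])
    show "AE x in lborel. x \<in> {0<..<T} \<longrightarrow> kernel_op (conv_kernel r') \<kappa>' x = kernel_op (conv_kernel ?H) q' x"
      using g
    proof eventually_elim
      case (elim x)
      show ?case
      proof
        assume x: "x \<in> {0<..<T}"
        have "kernel_op (conv_kernel r') \<kappa>' x = conv r \<kappa> x"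
          by (rule conv_eq_kernel_op[OF r, symmetric]) (use x representsD[OF \<kappa>] in auto)
        also have "\<dots> = g x" using elim x by simp
        also have "\<dots> = (\<integral>s. indicator {0..x} s *\<^sub>R q' s \<partial>lborel)"
        proof -
          have i: "integrable lborel (\<lambda>s. indicator {0..x} s *\<^sub>R q' s)"
            by (intro integrable_mult_indicator representsD(1)[OF q]) auto
          have ae: "AE s in lborel. s \<in> {0..x} \<longrightarrow> q' s = q s"
            using representsD(5)[OF q] AE_lborel_singleton[of 0]
            by eventually_elim (use x in auto)
          then obtain N where N: "N \<in> null_sets lborel" "{s. \<not> (s \<in> {0..x} \<longrightarrow> q' s = q s)} \<subseteq> N"
            by (auto simp: eventually_ae_filter)
          have negN: "negligible N"
            using N(1) by (simp add: negligible_iff_null_sets null_sets_completionI)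
          have "(q' has_integral g x) {0..x}"
            by (rule has_integral_spike[OF negN _ gq]) (use N(2) x in auto)
          moreover have "(q' has_integral (\<integral>s. indicator {0..x} s *\<^sub>R q' s \<partial>lborel)) {0..x}"
            using has_integral_set_lebesgue[of "{0..x}" q'] i
            by (simp add: set_integrable_def set_lebesgue_integral_def integrable_completion integral_completion)
          ultimately show ?thesis by (rule has_integral_unique)
        qed
        also have "\<dots> = kernel_op (conv_kernel ?H) q' x"
          unfolding kernel_op_def
        proof (rule integral_cong_AE)
          show "AE s in lborel. indicator {0..x} s *\<^sub>R q' s = conv_kernel ?H x s * q' s"
            using AE_lborel_singleton[of x] AE_lborel_singleton[of 0]
          proof eventually_elim
            case (elim s)
            then show ?case
              using x representsD(4)[OF q, of s] by (auto simp: conv_kernel_def indicator_def)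
          qed
          show "(\<lambda>s. conv_kernel ?H x s * q' s) \<in> borel_measurable lborel"
            unfolding conv_kernel_def by measurable
        qed measurable
        finally show "kernel_op (conv_kernel r') \<kappa>' x = kernel_op (conv_kernel ?H) q' x" .
      qed
    qed
    show "kernel_op (conv_kernel ?H) q' x = 0" if "x \<le> 0" for x
      by (rule kernel_op_conv_kernel_neg) (use that representsD(4)[OF q] in auto)
    fix t assume t: "t \<in> {0..T}"
    have "kernel_op (conv_kernel (kernel_op (conv_kernel ?H) q')) v' t =
        kernel_op (conv_kernel ?H) (kernel_op (conv_kernel q') v') t"
      by (rule kernel_op_conv_kernel_assoc[OF H representsD(1)[OF q] v'm B, symmetric])
    also have "\<dots> = integral {0..t} (kernel_op (conv_kernel q') v')"
    proof (rule kernel_op_heaviside[OF _ _ wc _ t])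
      show "kernel_op (conv_kernel q') v' s = 0" if "s < 0" for s
        using that by (intro kernel_op_conv_kernel_neg representsD(4)[OF q]) (auto simp: v'_def)
    qed auto
    finally show "kernel_op (conv_kernel (kernel_op (conv_kernel ?H) q')) (\<lambda>s. indicator {0..T} s *\<^sub>R v s) t =
        integral {0..t} (kernel_op (conv_kernel q') v')"
      by (simp add: v'_def[abs_def])
  qed
  then show ?thesis by (simp add: v'_def[abs_def])
qed

section \<open>The reduced equation\<close>

text \<open>
  The data of the Volterra equation \<open>v + V\<^sub>G v = f\<close> in Borel form. The kernel \<open>a 0\<close> stands for
  \<open>\<kappa>\<close> and \<open>a j\<close> for \<open>q\<^sub>j\<close> with \<open>1 \<le> j \<le> N\<close>, so that the coefficient \<open>p\<^sub>0\<close> is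
  treated together with the others.
\<close>

locale memory_equation =
  fixes T :: real and N :: nat and a p :: "nat \<Rightarrow> real \<Rightarrow> complex" and K :: "real \<Rightarrow> real \<Rightarrow> complex"
  assumes a_integrable: "j \<le> N \<Longrightarrow> integrable lborel (a j)"
    and a_supp: "j \<le> N \<Longrightarrow> x \<notin> {0<..<T} \<Longrightarrow> a j x = 0"
    and p_cont: "j \<le> N \<Longrightarrow> continuous_on {0..T} (p j)"
    and K_cont: "continuous_on (volterra_triangle T) (\<lambda>(t, s). K t s)"
begin

definition pz :: "nat \<Rightarrow> real \<Rightarrow> complex" where
  "pz j t = indicator {0..T} t *\<^sub>R p j t"

definition Kz :: "real \<Rightarrow> real \<Rightarrow> complex" where
  "Kz t s = indicator (volterra_triangle T) (t, s) *\<^sub>R K t s"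

definition Ka :: "real \<Rightarrow> real \<Rightarrow> complex" where
  "Ka t s = (\<integral>\<xi>. Kz t \<xi> * conv_kernel (a 0) \<xi> s \<partial>lborel)"

text \<open>
  The Borel form of \<open>G_S\<close>. The other factors already force \<open>s < t \<le> T\<close>; the indicator
  confines the kernel to \<open>s \<ge> 0\<close>, which gives it a bounded support.
\<close>

definition G :: "real \<Rightarrow> real \<Rightarrow> complex" where
  "G t s = indicator {0..} s *\<^sub>R ((\<Sum>j\<le>N. pz j t * conv_kernel (a j) t s) + Ka t s)"

lemma a_measurable: "j \<le> N \<Longrightarrow> a j \<in> borel_measurable borel"
  using a_integrable[of j] by auto

lemma Kz_measurable: "case_prod Kz \<in> borel_measurable (borel \<Otimes>\<^sub>M borel)"
proof -
  have "(\<lambda>z. indicator (volterra_triangle T) z *\<^sub>R (case z of (t, s) \<Rightarrow> K t s)) \<in> borel_measurable borel"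
    by (rule borel_measurable_continuous_on_indicator[OF _ K_cont])
       (simp add: compact_triangle borel_closed compact_imp_closed)
  then show ?thesis
    by (simp add: Kz_def borel_prod case_prod_unfold)
qed

lemma Kz_bound: obtains M where "\<And>t s. norm (Kz t s) \<le> M" "M \<ge> 0"
proof -
  have "bounded ((\<lambda>(t, s). K t s) ` volterra_triangle T)"
    by (intro compact_imp_bounded compact_continuous_image K_cont compact_triangle)
  then obtain M where M: "\<forall>z\<in>volterra_triangle T. norm (case z of (t, s) \<Rightarrow> K t s) \<le> M"
    by (auto simp: bounded_iff)
  have "norm (Kz t s) \<le> max M 0" for t s
    using M by (cases "(t, s) \<in> volterra_triangle T") (auto simp: Kz_def le_max_iff_disj)
  then show thesis by (rule that) simp
qed

lemma Kz_integrable: "integrable lborel (Kz t)"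
proof -
  obtain M where M: "\<And>t s. norm (Kz t s) \<le> M" "M \<ge> 0" by (rule Kz_bound) blast
  have "integrable lborel (\<lambda>s. M * indicator {0..T} s)"
    by (intro integrable_mult_right integrable_real_indicator) (auto simp: emeasure_lborel_Icc_eq)
  then show ?thesis
  proof (rule Bochner_Integration.integrable_bound)
    show "Kz t \<in> borel_measurable lborel"
      using kernel_section_measurable(1)[OF Kz_measurable] by simp
    have "norm (Kz t s) \<le> norm (M * indicator {0..T} s)" for s
    proof (cases "s \<in> {0..T}")
      case False
      then have "Kz t s = 0" by (auto simp: Kz_def)
      then show ?thesis by simp
    qed (use M in simp)
    then show "AE s in lborel. norm (Kz t s) \<le> norm (M * indicator {0..T} s)" by simp
  qed
qed

lemma pz_measurable: "j \<le> N \<Longrightarrow> pz j \<in> borel_measurable borel"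
  unfolding pz_def[abs_def] by (rule borel_measurable_continuous_on_indicator[OF _ p_cont]) auto

lemma Ka_measurable: "case_prod Ka \<in> borel_measurable (borel \<Otimes>\<^sub>M borel)"
proof -
  note [measurable] = Kz_measurable conv_kernel_measurable[OF a_measurable, of 0]
  have "(\<lambda>z. \<integral>\<xi>. case_prod Kz (fst z, \<xi>) * case_prod (conv_kernel (a 0)) (\<xi>, snd z) \<partial>lborel)
      \<in> borel_measurable (borel \<Otimes>\<^sub>M borel)"
    by measurable
  then show ?thesis by (simp add: Ka_def[abs_def] case_prod_unfold)
qed

lemma G_measurable: "case_prod G \<in> borel_measurable (borel \<Otimes>\<^sub>M borel)"
proof -
  note [measurable] = Ka_measurable
  have [measurable]: "case_prod (conv_kernel (a j)) \<in> borel_measurable (borel \<Otimes>\<^sub>M borel)"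
    "pz j \<in> borel_measurable borel" if "j \<in> {..N}" for j
    using that conv_kernel_measurable[OF a_measurable] pz_measurable by auto
  have "(\<lambda>z. indicator {0..} (snd z) *\<^sub>R
      ((\<Sum>j\<le>N. pz j (fst z) * case_prod (conv_kernel (a j)) z) + case_prod Ka z))
      \<in> borel_measurable (borel \<Otimes>\<^sub>M borel)"
    by measurable
  then show ?thesis by (simp add: G_def[abs_def] case_prod_unfold)
qed

lemma G_supp: "\<not> (0 \<le> s \<and> s < t \<and> t \<le> T) \<Longrightarrow> G t s = 0"
proof -
  assume st: "\<not> (0 \<le> s \<and> s < t \<and> t \<le> T)"
  show ?thesis
  proof (cases "0 \<le> s")
    case True
    with st have st: "t \<le> s \<or> T < t" by auto
    have "pz j t * conv_kernel (a j) t s = 0" if "j \<le> N" for j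
      using st a_supp[OF that, of "t - s"] by (auto simp: pz_def conv_kernel_def)
    then have "(\<Sum>j\<le>N. pz j t * conv_kernel (a j) t s) = 0"
      by (intro sum.neutral) blast
    moreover have "(\<lambda>\<xi>. Kz t \<xi> * conv_kernel (a 0) \<xi> s) = (\<lambda>_. 0)"
    proof
      fix \<xi> show "Kz t \<xi> * conv_kernel (a 0) \<xi> s = 0"
        using st a_supp[of 0 "\<xi> - s"] by (auto simp: Kz_def conv_kernel_def indicator_def)
    qed
    then have "Ka t s = 0" by (simp only: Ka_def) simp
    ultimately show ?thesis by (simp only: G_def) simp
  qed (simp add: G_def)
qed

text \<open>
  The coefficients are bounded, so the sum is dominated by a combination of the \<open>|a\<^sub>j(t - s)|\<close>, and
  the memory part is bounded by \<open>sup |K|\<close> times the \<open>L\<^sup>1\<close> norm of \<open>a\<^sub>0\<close>.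
\<close>

lemma G_volterra_kernel: "\<exists>h. volterra_kernel T h G"
proof -
  obtain M where M: "\<And>t s. norm (Kz t s) \<le> M" "M \<ge> 0" by (rule Kz_bound) blast
  have "\<exists>P. \<forall>t. norm (pz j t) \<le> P" if "j \<le> N" for j
    using continuous_extension_by_zero[OF p_cont[OF that]] unfolding pz_def by metis
  then obtain P where P: "\<And>j t. j \<le> N \<Longrightarrow> norm (pz j t) \<le> P j" by metis
  define c where "c = M * (\<integral>x. norm (a 0 x) \<partial>lborel)"
  have Ka_le: "norm (Ka t s) \<le> c" for t s
  proof -
    have i: "integrable lborel (\<lambda>\<xi>. a 0 (\<xi> - s))"
      using lborel_integrable_real_affine[OF a_integrable[of 0], of 1 "-s"] by simp
    have "norm (Ka t s) \<le> (\<integral>\<xi>. M * norm (a 0 (\<xi> - s)) \<partial>lborel)"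
      unfolding Ka_def conv_kernel_def
    proof (rule order_trans[OF integral_norm_bound])
      have [measurable]: "Kz t \<in> borel_measurable borel"
        by (rule kernel_section_measurable[OF Kz_measurable])
      have le: "norm (Kz t \<xi> * a 0 (\<xi> - s)) \<le> M * norm (a 0 (\<xi> - s))" for \<xi>
        using M(1) by (simp add: norm_mult mult_right_mono)
      have "integrable lborel (\<lambda>\<xi>. M * norm (a 0 (\<xi> - s)))" using i by simp
      moreover from this have "integrable lborel (\<lambda>\<xi>. Kz t \<xi> * a 0 (\<xi> - s))"
        by (rule Bochner_Integration.integrable_bound)
           (use i le M(2) in \<open>auto intro!: AE_I2 simp: abs_mult\<close>)
      ultimately show "(\<integral>\<xi>. norm (Kz t \<xi> * a 0 (\<xi> - s)) \<partial>lborel) \<le> (\<integral>\<xi>. M * norm (a 0 (\<xi> - s)) \<partial>lborel)"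
        by (intro integral_mono) (use le in auto)
    qed
    also have "\<dots> = c"
      using lborel_integral_real_affine[of 1 "\<lambda>x. norm (a 0 x)" "-s"] by (simp add: c_def)
    finally show ?thesis .
  qed
  have "c \<ge> 0" using M by (simp add: c_def)
  have "P j \<ge> 0" if "j \<le> N" for j
    using P[OF that, of 0] norm_ge_zero order_trans by blast
  define h where "h x = (\<Sum>j\<le>N. P j * norm (a j x)) + c * indicator {0..T} x" for x
  have "volterra_kernel T h G"
  proof
    show "case_prod G \<in> borel_measurable (borel \<Otimes>\<^sub>M borel)" by (rule G_measurable)
    show "integrable lborel h"
      unfolding h_def
      by (intro Bochner_Integration.integrable_add Bochner_Integration.integrable_sum integrable_mult_right
            integrable_norm a_integrable integrable_real_indicator)
         (auto simp: emeasure_lborel_Icc_eq)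
    show "norm (G t s) \<le> h (t - s)" for t s
    proof (cases "0 \<le> s \<and> s < t \<and> t \<le> T")
      case True
      have "norm (G t s) \<le> norm (\<Sum>j\<le>N. pz j t * conv_kernel (a j) t s) + norm (Ka t s)"
        using True by (simp add: G_def norm_triangle_ineq)
      also have "\<dots> \<le> (\<Sum>j\<le>N. P j * norm (a j (t - s))) + c"
        by (intro add_mono Ka_le order_trans[OF norm_sum] sum_mono)
           (auto simp: norm_mult conv_kernel_def intro!: mult_right_mono P)
      finally show ?thesis using True by (simp add: h_def)
    next
      case False
      then show ?thesis
        using G_supp[OF False] \<open>c \<ge> 0\<close> \<open>\<And>j. j \<le> N \<Longrightarrow> P j \<ge> 0\<close>
        by (auto simp: h_def intro!: add_nonneg_nonneg sum_nonneg)
    qed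
  qed (rule G_supp)
  then show ?thesis by blast
qed

text \<open>
  This identifies \<open>V\<^sub>G v\<close> with the terms other than \<open>D\<^sub>k u\<close> of the equation at
  \<open>u = a\<^sub>0 * v\<close>. The memory
  part is the composition of \<open>K\<close> with convolution by \<open>a\<^sub>0\<close>.
\<close>

lemma kernel_op_G:
  assumes vm: "v \<in> borel_measurable borel" and B: "\<And>s. norm (v s) \<le> B" and v0: "\<And>s. s < 0 \<Longrightarrow> v s = 0"
  shows "kernel_op G v t = (\<Sum>j\<le>N. pz j t * kernel_op (conv_kernel (a j)) v t) +
    kernel_op Kz (kernel_op (conv_kernel (a 0)) v) t"
proof -
  obtain h where "volterra_kernel T h G" using G_volterra_kernel by blast
  then interpret volterra_kernel T h G .
  obtain A where A: "\<And>n t. integrable lborel (kernel_power G n t)" by (rule power_L1_bound) blast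
  have Gi: "integrable lborel (\<lambda>s. G t s * v s)"
    by (rule norm_kernel_op_le(1)[of G t, OF _ vm B]) (use A[of 0 t] in simp)
  have ai: "integrable lborel (\<lambda>s. pz j t * (conv_kernel (a j) t s * v s))" if "j \<in> {..N}" for j
    by (intro integrable_mult_right norm_kernel_op_le(1)[of "conv_kernel (a j)" t, OF _ vm B]
          conv_kernel_integrable a_integrable) (use that in simp)
  have "kernel_op Kz (kernel_op (conv_kernel (a 0)) v) t = kernel_op Ka v t"
    unfolding Ka_def[abs_def]
    by (rule kernel_op_comp[where b = "\<integral>s. norm (a 0 s) \<partial>lborel", OF Kz_measurable _ vm Kz_integrable _ _ B])
       (simp_all add: conv_kernel_measurable conv_kernel_integrable a_integrable a_measurable)
  also have "\<dots> = (\<integral>s. G t s * v s - (\<Sum>j\<le>N. pz j t * (conv_kernel (a j) t s * v s)) \<partial>lborel)"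
    unfolding kernel_op_def
  proof (rule Bochner_Integration.integral_cong)
    fix s
    show "Ka t s * v s = G t s * v s - (\<Sum>j\<le>N. pz j t * (conv_kernel (a j) t s * v s))"
      using v0[of s] by (cases "s < 0") (auto simp: G_def algebra_simps sum_distrib_left)
  qed simp
  also have "\<dots> = kernel_op G v t - (\<Sum>j\<le>N. pz j t * kernel_op (conv_kernel (a j)) v t)"
  proof -
    have "(\<integral>s. (\<Sum>j\<le>N. pz j t * (conv_kernel (a j) t s * v s)) \<partial>lborel) =
        (\<Sum>j\<le>N. \<integral>s. pz j t * (conv_kernel (a j) t s * v s) \<partial>lborel)"
      by (rule Bochner_Integration.integral_sum) (rule ai)
    moreover have "integrable lborel (\<lambda>s. \<Sum>j\<le>N. pz j t * (conv_kernel (a j) t s * v s))"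
      by (rule Bochner_Integration.integrable_sum) (rule ai)
    ultimately show ?thesis
      using Gi by (simp add: kernel_op_def)
  qed
  finally show ?thesis by simp
qed

lemma continuous_on_kernel_op_Kz:
  assumes w: "continuous_on {0..T} w"
  shows "continuous_on {0..T} (kernel_op Kz w)"
proof -
  have "continuous_on (volterra_triangle T) (w \<circ> snd)"
    by (intro continuous_on_compose continuous_on_subset[OF w]) (auto intro!: continuous_intros)
  then have "continuous_on (volterra_triangle T) (\<lambda>z. (case z of (t, s) \<Rightarrow> K t s) * (w \<circ> snd) z)"
    by (intro continuous_on_mult K_cont)
  moreover have "integrable lborel (\<lambda>x. of_real (indicator {0..T} x) :: complex)"
    by (intro integrable_of_real integrable_real_indicator) (auto simp: emeasure_lborel_Icc_eq)
  ultimately have "continuous_on {0..T}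
      (\<lambda>t. \<integral>x. indicator {0..t} x *\<^sub>R (K t x * w x) * of_real (indicator {0..T} x) \<partial>lborel)"
    by (intro continuous_on_volterra_integral) (simp_all add: case_prod_unfold)
  then show ?thesis
  proof (rule continuous_on_eq)
    fix t assume t: "t \<in> {0..T}"
    have "indicator {0..t} x *\<^sub>R (K t x * w x) * of_real (indicator {0..T} x) = Kz t x * w x" for x
      using t by (auto simp: Kz_def indicator_def)
    then show "(\<integral>x. indicator {0..t} x *\<^sub>R (K t x * w x) * of_real (indicator {0..T} x) \<partial>lborel) = kernel_op Kz w t"
      by (simp only: kernel_op_def)
  qed
qed

text \<open>
  Continuity is read off from the decomposition of \<open>kernel_op_G\<close>: convolutions with integrable
  functions and Volterra integrals with continuous kernels are continuous in \<open>t\<close>.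
\<close>

lemma continuous_on_kernel_op_G:
  assumes vm: "v \<in> borel_measurable borel" and B: "\<And>s. norm (v s) \<le> B" and vc: "continuous_on {0..T} v"
  shows "continuous_on {0..T} (kernel_op G v)"
proof -
  define v' where "v' s = indicator {0..T} s *\<^sub>R v s" for s
  have v'm: "v' \<in> borel_measurable borel" using vm unfolding v'_def[abs_def] by measurable
  have v'B: "norm (v' s) \<le> B" for s
    using B[of s] order_trans[OF norm_ge_zero B[of s]] by (simp add: v'_def indicator_def)
  have v'c: "continuous_on {0..T} v'"
    unfolding v'_def[abs_def] by (rule continuous_on_extension_by_zero[OF vc])
  have v'0: "v' s = 0" if "s < 0" for s using that by (simp add: v'_def)
  have conv: "continuous_on {0..T} (kernel_op (conv_kernel (a j)) v')" if "j \<le> N" for j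
    by (rule continuous_on_kernel_op_conv_kernel[OF a_integrable[OF that] _ v'c v'0])
       (use a_supp[OF that] in auto)
  have pzc: "continuous_on {0..T} (pz j)" if "j \<le> N" for j
    unfolding pz_def[abs_def] by (rule continuous_on_extension_by_zero[OF p_cont[OF that]])
  have "G t s * v s = G t s * v' s" for t s
    using G_supp[of s t] by (cases "s \<in> {0..T}") (auto simp: v'_def)
  then have "kernel_op G v = kernel_op G v'"
    by (intro ext) (simp only: kernel_op_def)
  also have "\<dots> = (\<lambda>t. (\<Sum>j\<le>N. pz j t * kernel_op (conv_kernel (a j)) v' t) +
    kernel_op Kz (kernel_op (conv_kernel (a 0)) v') t)"
    using kernel_op_G[OF v'm v'B v'0] by blast
  finally have eq: "kernel_op G v = \<dots>" .
  show ?thesis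
    unfolding eq
    by (intro continuous_on_add continuous_on_sum continuous_on_mult pzc conv continuous_on_kernel_op_Kz) auto
qed

end

section \<open>Unique solvability\<close>

theorem theorem4:
  fixes T :: real and \<kappa> k :: "real \<Rightarrow> complex" and N :: nat
    and kj g q p :: "nat \<Rightarrow> real \<Rightarrow> complex"
    and K :: "real \<Rightarrow> real \<Rightarrow> complex" and f :: "real \<Rightarrow> complex"
  assumes T_pos: "T > 0"
    and sonine: "sonine_pair T \<kappa> k"
    and \<kappa>_bound: "\<exists>C>0. \<exists>\<eta>>0. \<forall>t\<in>{0<..T}. norm (\<kappa> t) \<le> C * t powr (\<eta> - 1)"
    and \<kappa>_nonvanishing: "\<And>\<epsilon>. \<epsilon> > 0 \<Longrightarrow> \<not> (AE t in lebesgue. t \<in> {0<..<\<epsilon>} \<longrightarrow> \<kappa> t = 0)"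
    and kj_L1: "\<And>j. j \<in> {1..N} \<Longrightarrow> set_integrable lebesgue {0<..<T} (kj j)"
    and g_conv: "\<And>j. j \<in> {1..N} \<Longrightarrow> AE t in lebesgue. t \<in> {0<..<T} \<longrightarrow> g j t = conv (kj j) \<kappa> t"
    and g_AC: "\<And>j. j \<in> {1..N} \<Longrightarrow> absolutely_continuous_on 0 T (g j)"
    and g_zero: "\<And>j. j \<in> {1..N} \<Longrightarrow> g j 0 = 0"
    and q_deriv: "\<And>j. j \<in> {1..N} \<Longrightarrow>
      AE t in lebesgue. t \<in> {0<..<T} \<longrightarrow> (g j has_vector_derivative q j t) (at t)"
    and q_bound: "\<And>j. j \<in> {1..N} \<Longrightarrow>
      \<exists>C>0. \<exists>\<eta>>0. AE t in lebesgue. t \<in> {0<..<T} \<longrightarrow> norm (q j t) \<le> C * t powr (\<eta> - 1)"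
    and p_cont: "\<And>j. j \<in> {0..N} \<Longrightarrow> continuous_on {0..T} (p j)"
    and K_cont: "continuous_on {(t, s). 0 \<le> s \<and> s \<le> t \<and> t \<le> T} (\<lambda>(t, s). K t s)"
    and f_cont: "continuous_on {0..T} f"
  defines "R_S \<equiv> resolvent_kernel (G_S \<kappa> N q p K)"
  defines "u\<^sub>0 \<equiv> conv_op T \<kappa> (\<lambda>t. f t - volterra_op T R_S f t)"
  shows "(\<exists>!u. u \<in> conv_op T \<kappa> ` C_space T \<and> solves_equation T k N kj p K f u) \<and>
         u\<^sub>0 \<in> conv_op T \<kappa> ` C_space T \<and> solves_equation T k N kj p K f u\<^sub>0"
proof -
  have q_int: "\<And>j x. \<lbrakk>j \<in> {1..N}; x \<in> {0..T}\<rbrakk> \<Longrightarrow> (q j has_integral g j x) {0..x}"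
    and q_L1: "\<And>j. j \<in> {1..N} \<Longrightarrow> set_integrable lebesgue {0<..<T} (q j)"
    using absolutely_continuous_primitive[OF T_pos g_AC g_zero q_deriv q_bound] by blast+
  obtain \<kappa>' where \<kappa>': "represents T \<kappa>' \<kappa>"
    using sonine represents_exists unfolding sonine_pair_def by blast
  obtain k' where k': "represents T k' k"
    using sonine represents_exists unfolding sonine_pair_def by blast
  have "\<forall>j\<in>{1..N}. \<exists>r'. represents T r' (kj j)" "\<forall>j\<in>{1..N}. \<exists>r'. represents T r' (q j)"
    using kj_L1 q_L1 represents_exists by blast+
  then obtain kj' q' where kj': "\<And>j. j \<in> {1..N} \<Longrightarrow> represents T (kj' j) (kj j)"
    and q': "\<And>j. j \<in> {1..N} \<Longrightarrow> represents T (q' j) (q j)"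
    by metis
  define a where "a j = (if j = 0 then \<kappa>' else q' j)" for j :: nat
  define b where "b j = (if j = 0 then \<kappa> else q j)" for j :: nat
  have ab: "represents T (a j) (b j)" if "j \<le> N" for j
    using that \<kappa>' q'[of j] by (auto simp: a_def b_def)
  have sum0: "(\<Sum>j\<le>N. F j) = F 0 + (\<Sum>j=1..N. F j)" for F :: "nat \<Rightarrow> complex"
    by (simp add: sum.atMost_shift sum.atLeast1_atMost_eq)
  interpret memory_equation T N a p K
  proof
    show "continuous_on {0..T} (p j)" if "j \<le> N" for j using p_cont that by simp
    show "a j x = 0" if "j \<le> N" "x \<notin> {0<..<T}" for j x
      by (rule representsD(3)[OF ab[OF that(1)] that(2)])
  qed (use ab representsD(1) K_cont in auto)
  obtain h where "volterra_kernel T h G" using G_volterra_kernel by blast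
  then interpret volterra_kernel T h G .

  have good: "AE x in lborel. x \<in> {0<..<T} \<longrightarrow> (\<forall>j\<in>{..N}. a j x = b j x)"
  proof -
    have "AE x in lborel. \<forall>j\<in>{..N}. x \<in> {0<..<T} \<longrightarrow> a j x = b j x"
      by (rule AE_finite_allI) (use ab representsD(5) in auto)
    then show ?thesis by eventually_elim auto
  qed
  have K\<kappa>: "(LINT \<xi>:{s..t}|lebesgue. K t \<xi> * \<kappa> (\<xi> - s)) = Ka t s" if "0 \<le> s" "t \<le> T" for t s
    unfolding Ka_def
  proof (rule set_lebesgue_integral_eq_lborel)
    note [measurable] = kernel_section_measurable(1)[OF Kz_measurable]
      kernel_section_measurable(2)[OF conv_kernel_measurable[OF a_measurable[of 0]]]
    show "(\<lambda>\<xi>. Kz t \<xi> * conv_kernel (a 0) \<xi> s) \<in> borel_measurable borel" by measurable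
    show "AE \<xi> in lborel. \<xi> \<in> {s..t} \<longrightarrow> K t \<xi> * \<kappa> (\<xi> - s) = Kz t \<xi> * conv_kernel (a 0) \<xi> s"
      using AE_lborel_translate[OF representsD(5)[OF \<kappa>'], of s] AE_lborel_singleton[of s] AE_lborel_singleton[of T]
      by eventually_elim (use that in \<open>auto simp: Kz_def conv_kernel_def a_def\<close>)
    show "Kz t \<xi> * conv_kernel (a 0) \<xi> s = 0" if "\<xi> \<notin> {s..t}" for \<xi>
      using that a_supp[of 0 "\<xi> - s"] by (auto simp: Kz_def conv_kernel_def)
  qed
  \<comment> \<open>all representatives agree with the given kernels at the argument \<open>t - s\<close>\<close>
  have GS: "G_S \<kappa> N q p K t s = G t s"
    if "0 \<le> s" "s \<le> t" "t \<le> T" "\<forall>j\<in>{..N}. a j (t - s) = b j (t - s)" for t s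
  proof -
    have "G t s = (\<Sum>j\<le>N. p j t * b j (t - s)) + Ka t s"
      using that by (simp add: G_def pz_def conv_kernel_def)
    also have "(\<Sum>j\<le>N. p j t * b j (t - s)) = p 0 t * \<kappa> (t - s) + (\<Sum>j=1..N. p j t * q j (t - s))"
      unfolding sum0 by (simp add: b_def)
    finally show ?thesis using K\<kappa>[of s t] that by (simp add: G_S_def)
  qed
  have row: "AE s in lborel. s \<in> {0..t} \<longrightarrow> G_S \<kappa> N q p K t s = G t s" if "t \<in> {0..T}" for t
    using AE_lborel_reflect[OF good, of t] AE_lborel_singleton[of t] AE_lborel_singleton[of 0]
    by eventually_elim (use that in \<open>auto intro!: GS\<close>)
  have col: "AE t in lborel. t \<in> {s..T} \<longrightarrow> G_S \<kappa> N q p K t s = G t s" if "s \<in> {0..T}" for s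
    using AE_lborel_translate[OF good, of s] AE_lborel_singleton[of s] AE_lborel_singleton[of T]
    by eventually_elim (use that in \<open>auto intro!: GS\<close>)

  \<comment> \<open>reduction of the equation for \<open>u = I\<^sub>\<kappa> v\<close> to \<open>v + V\<^sub>G v = f\<close>\<close>
  have lhs: "D_op T k u t + p 0 t * u t + (\<Sum>j=1..N. p j t * D_op T (kj j) u t)
          + (LINT s:{0..t}|lebesgue. K t s * u s) = v' t + kernel_op G v' t"
    if v: "continuous_on {0..T} v" and t: "t \<in> {0..T}" and v': "v' = (\<lambda>s. indicator {0..T} s *\<^sub>R v s)"
      and u: "u = conv_op T \<kappa> v" for u v v' t
  proof -
    obtain B where v'm: "v' \<in> borel_measurable borel" and B: "\<And>s. norm (v' s) \<le> B"
      unfolding v' by (rule continuous_extension_by_zero[OF v]) blast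
    have v'0: "v' s = 0" if "s < 0" for s using that by (simp add: v')
    have 1: "D_op T k u t = v' t"
      using D_op_sonine[OF T_pos k' \<kappa>' _ v t] sonine t by (simp add: u v' sonine_pair_def)
    have 2: "u s = kernel_op (conv_kernel (a 0)) v' s" if "s \<in> {0..T}" for s
      using conv_op_eq_kernel_op[OF \<kappa>' v that] by (simp add: u v' a_def)
    have 3: "D_op T (kj j) u t = kernel_op (conv_kernel (a j)) v' t" if j: "j \<in> {1..N}" for j
    proof -
      have "AE x in lborel. x \<in> {0<..<T} \<longrightarrow> g j x = conv (kj j) \<kappa> x"
        using g_conv[OF j] by (simp add: AE_completion_iff)
      from D_op_primitive[OF T_pos kj'[OF j] \<kappa>' q'[OF j] this q_int[OF j] v t]
      show ?thesis using j by (simp add: u v' a_def)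
    qed
    have 4: "(LINT s:{0..t}|lebesgue. K t s * u s) = kernel_op Kz (kernel_op (conv_kernel (a 0)) v') t"
      unfolding kernel_op_def[of Kz]
    proof (rule set_lebesgue_integral_eq_lborel)
      have "kernel_op (conv_kernel (a 0)) v' \<in> borel_measurable borel"
        by (intro borel_measurable_kernel_op conv_kernel_measurable a_measurable v'm) simp
      then show "(\<lambda>s. Kz t s * kernel_op (conv_kernel (a 0)) v' s) \<in> borel_measurable borel"
        using kernel_section_measurable(1)[OF Kz_measurable] by (intro borel_measurable_times)
      show "AE s in lborel. s \<in> {0..t} \<longrightarrow> K t s * u s = Kz t s * kernel_op (conv_kernel (a 0)) v' s"
        using 2 t by (intro AE_I2) (auto simp: Kz_def)
      show "Kz t s * kernel_op (conv_kernel (a 0)) v' s = 0" if "s \<notin> {0..t}" for s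
        using that by (auto simp: Kz_def)
    qed
    have "kernel_op G v' t = p 0 t * kernel_op (conv_kernel (a 0)) v' t +
        (\<Sum>j=1..N. p j t * kernel_op (conv_kernel (a j)) v' t) +
        kernel_op Kz (kernel_op (conv_kernel (a 0)) v') t"
    proof -
      have "pz j t = p j t" for j using t by (simp add: pz_def)
      then show ?thesis using kernel_op_G[OF v'm B v'0, of t] by (simp only: sum0)
    qed
    then show ?thesis using 1 2[OF t] 3 4 by simp
  qed

  define f' where "f' s = indicator {0..T} s *\<^sub>R f s" for s
  obtain B where f'm: "f' \<in> borel_measurable borel" and B: "\<And>s. norm (f' s) \<le> B"
    unfolding f'_def[abs_def] by (rule continuous_extension_by_zero[OF f_cont]) blast
  have f'c: "continuous_on {0..T} f'"
    unfolding f'_def[abs_def] by (rule continuous_on_extension_by_zero[OF f_cont])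
  define w where "w t = f' t - kernel_op (neumann_kernel G) f' t" for t
  have w_out: "w t = 0" if "t \<notin> {0..T}" for t
  proof -
    have "(\<lambda>s. neumann_kernel G t s * f' s) = (\<lambda>_. 0)"
      using neumann_kernel_supp that by fastforce
    then have "kernel_op (neumann_kernel G) f' t = 0" by (simp only: kernel_op_def) simp
    then show ?thesis using that by (simp add: w_def f'_def)
  qed
  have w_cont: "continuous_on {0..T} w"
    unfolding w_def[abs_def]
    by (intro continuous_on_diff f'c continuous_on_kernel_op_neumann[OF f'm B f'c] continuous_on_kernel_op_G)
  have w_ext: "w = (\<lambda>s. indicator {0..T} s *\<^sub>R w s)"
    using w_out by (auto simp: fun_eq_iff indicator_def)
  \<comment> \<open>also off \<open>[0,T]\<close>, where both sides vanish\<close>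
  have w_eq: "w t + kernel_op G w t = f' t" for t
    using neumann_kernel_solves[OF f'm B] by (simp add: w_def[abs_def])
  have u0: "u\<^sub>0 = conv_op T \<kappa> (restrict w {0..T})" "u\<^sub>0 = conv_op T \<kappa> w"
  proof -
    have "f t - volterra_op T R_S f t = w t" if "t \<in> {0..T}" for t
      using volterra_op_resolvent_eq[OF row col f_cont that] that
      by (simp add: R_S_def w_def f'_def[abs_def])
    then have "conv \<kappa> (\<lambda>t. f t - volterra_op T R_S f t) t = conv \<kappa> w t"
      "conv \<kappa> (restrict w {0..T}) t = conv \<kappa> w t" if "t \<in> {0..T}" for t
      using that unfolding conv_def by (auto intro!: set_lebesgue_integral_cong)
    then show "u\<^sub>0 = conv_op T \<kappa> (restrict w {0..T})" "u\<^sub>0 = conv_op T \<kappa> w"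
      unfolding u\<^sub>0_def conv_op_def by (auto simp: fun_eq_iff)
  qed
  have mem: "u\<^sub>0 \<in> conv_op T \<kappa> ` C_space T"
  proof -
    have "continuous_on {0..T} (restrict w {0..T})"
      by (rule continuous_on_eq[OF w_cont]) simp
    then show ?thesis unfolding u0(1) by (intro imageI) (simp add: C_space_def extensional_def)
  qed
  have sol: "solves_equation T k N kj p K f u\<^sub>0"
    unfolding solves_equation_def
    using lhs[OF w_cont _ w_ext u0(2)] w_eq by (simp add: f'_def)
  have uniq: "u = u\<^sub>0" if u_in: "u \<in> conv_op T \<kappa> ` C_space T" and u_sol: "solves_equation T k N kj p K f u" for u
  proof -
    obtain v where u: "u = conv_op T \<kappa> v" and v: "continuous_on {0..T} v"
      using u_in by (auto simp: C_space_def)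
    define v' where "v' = (\<lambda>s. indicator {0..T} s *\<^sub>R v s)"
    obtain B1 where v'm: "v' \<in> borel_measurable borel" and B1: "\<And>s. norm (v' s) \<le> B1"
      unfolding v'_def by (rule continuous_extension_by_zero[OF v]) blast
    obtain B2 where wm: "w \<in> borel_measurable borel" and B2: "\<And>s. norm (w s) \<le> B2"
      using continuous_extension_by_zero[OF w_cont] w_ext by metis
    have v'_eq: "v' t + kernel_op G v' t = f' t" if t: "t \<in> {0..T}" for t
      using lhs[OF v t v'_def u] u_sol t
      by (simp add: solves_equation_def f'_def)
    obtain A where A: "\<And>n t. integrable lborel (kernel_power G n t)" by (rule power_L1_bound) blast
    have Gi: "integrable lborel (G t)" for t using A[of 0 t] by simp
    have "(v' t - w t) + kernel_op G (\<lambda>t. v' t - w t) t = 0" for t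
    proof (cases "t \<in> {0..T}")
      case True
      have "kernel_op G (\<lambda>t. v' t - w t) t = kernel_op G v' t - kernel_op G w t"
        unfolding kernel_op_def right_diff_distrib
        by (intro Bochner_Integration.integral_diff norm_kernel_op_le(1)[of G t, OF Gi v'm B1]
              norm_kernel_op_le(1)[of G t, OF Gi wm B2])
      then have "(v' t - w t) + kernel_op G (\<lambda>t. v' t - w t) t =
          (v' t + kernel_op G v' t) - (w t + kernel_op G w t)" by simp
      then show ?thesis unfolding v'_eq[OF True] w_eq by simp
    next
      case False
      have "(\<lambda>s. G t s * (v' s - w s)) = (\<lambda>_. 0)"
        using G_supp False by fastforce
      then have "kernel_op G (\<lambda>t. v' t - w t) t = 0" by (simp only: kernel_op_def) simp
      then show ?thesis using False w_out by (simp add: v'_def)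
    qed
    then have zero: "v' t - w t = 0" for t
    proof (rule homogeneous_solution_zero[rotated 2])
      show "(\<lambda>t. v' t - w t) \<in> borel_measurable borel" using v'm wm by measurable
      show "norm (v' t - w t) \<le> B1 + B2" for t
        using norm_triangle_ineq4[of "v' t" "w t"] B1[of t] B2[of t] by linarith
    qed
    have "v t = w t" if "t \<in> {0..T}" for t
      using zero[of t] that by (simp add: v'_def)
    then have "conv \<kappa> v t = conv \<kappa> w t" if "t \<in> {0..T}" for t
      using that unfolding conv_def by (auto intro!: set_lebesgue_integral_cong)
    then show ?thesis unfolding u u0(2) conv_op_def by (auto simp: fun_eq_iff)
  qed
  show ?thesis
    by (intro conjI ex1I[of _ u\<^sub>0] mem sol) (erule conjE, rule uniq; assumption)
qed

end
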